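(* Let $\ell$ be an odd prime, $n$ a positive integer and $t$ an integer, and let $\Phi(x)=T_\ell^n(x)-t$. Suppose $\Phi$ is irreducible over $\mathbb{Q}$, let $\theta$ be a root of $\Phi$ and $K=\mathbb{Q}(\theta)$. Then $D(\Phi)=\Delta(K)$ if and only if (1) $T_\ell(t)-t\not\equiv 0\pmod{\ell^2}$, and (2) both $t-2$ and $t+2$ are square-free.
   Context: $T_d(x)$ is the Chebyshev polynomial of the first kind of degree $d$ (the unique monic polynomial with $T_d(z+z^{-1})=z^d+z^{-d}$; it has integer coefficients), and $T_\ell^n$ denotes the $n$-fold composition of $T_\ell$. $D(\Phi)=\prod_{i<j}(\theta_j-\theta_i)^2$ is the discriminant of the polynomial $\Phi$, and $\Delta(K)$ is the discriminant of the number field $K$. (Equivalently, the condition $D(\Phi)=\Delta(K)$ means $\mathcal{O}_K=\mathbb{Z}[\theta]$.) *)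

theory Defs
  imports
    "Jordan_Normal_Form.Determinant"
    "HOL-Number_Theory.Cong"
    "HOL-Computational_Algebra.Computational_Algebra"
begin

(* The normalisation T_d(z + 1/z) = z^d + 1/z^d, i.e. T_d(2 cos x) = 2 cos (d x). For d = 0 no
   monic polynomial satisfies the identity (it would be the constant 2), so chebyshev_T is only
   meaningful for d > 0; see chebyshev_T_ex1. *)
definition chebyshev_T :: "nat \<Rightarrow> int poly" where
  "chebyshev_T d = (THE p. lead_coeff p = 1 \<and>
     (\<forall>z::complex. z \<noteq> 0 \<longrightarrow> poly (map_poly of_int p) (z + inverse z) = z ^ d + inverse z ^ d))"

definition chebyshev_T_iter :: "nat \<Rightarrow> nat \<Rightarrow> int poly" where
  "chebyshev_T_iter d n = (pcompose (chebyshev_T d) ^^ n) [:0, 1:]"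

(* Discriminant of a monic polynomial: the usual factor lead_coeff p ^ (2 * degree p - 2) is
   absent. The roots are listed with multiplicity; the order of the list does not matter. *)
definition monic_discriminant :: "complex poly \<Rightarrow> complex" where
  "monic_discriminant p = (let r = (SOME r. mset r = proots p) in
     \<Prod>j<length r. \<Prod>i<j. (r ! j - r ! i)\<^sup>2)"

definition complex_subfield :: "complex set \<Rightarrow> bool" where
  "complex_subfield K \<longleftrightarrow> 0 \<in> K \<and> 1 \<in> K \<and>
     (\<forall>x\<in>K. \<forall>y\<in>K. x + y \<in> K \<and> x * y \<in> K) \<and> (\<forall>x\<in>K. - x \<in> K \<and> inverse x \<in> K)"

definition rat_adjoin :: "complex \<Rightarrow> complex set" where
  "rat_adjoin \<theta> = \<Inter> {K. complex_subfield K \<and> \<theta> \<in> K}"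

definition ring_of_integers :: "complex set \<Rightarrow> complex set" where
  "ring_of_integers K = {x \<in> K. algebraic_int x}"

definition integral_basis :: "complex set \<Rightarrow> complex list \<Rightarrow> bool" where
  "integral_basis K b \<longleftrightarrow> set b \<subseteq> ring_of_integers K \<and>
     (\<forall>x\<in>ring_of_integers K. \<exists>!c :: int list.
        length c = length b \<and> x = (\<Sum>i<length b. of_int (c ! i) * b ! i))"

(* Extensionality makes embeddings that agree on K equal, so that a number field K of degree n
   has exactly n of them. *)
definition field_embeddings :: "complex set \<Rightarrow> (complex \<Rightarrow> complex) set" where
  "field_embeddings K = {\<sigma> \<in> extensional K. \<sigma> 1 = 1 \<and>
     (\<forall>x\<in>K. \<forall>y\<in>K. \<sigma> (x + y) = \<sigma> x + \<sigma> y \<and> \<sigma> (x * y) = \<sigma> x * \<sigma> y)}"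

definition field_trace :: "complex set \<Rightarrow> complex \<Rightarrow> complex" where
  "field_trace K x = (\<Sum>\<sigma>\<in>field_embeddings K. \<sigma> x)"

(* The discriminant of a number field, independent of the integral basis; it is a rational
   integer, regarded here as a complex number. *)
definition field_discriminant :: "complex set \<Rightarrow> complex" where
  "field_discriminant K = (let b = (SOME b. integral_basis K b) in
     det (mat (length b) (length b) (\<lambda>(i, j). field_trace K (b ! i * b ! j))))"

lemma chebyshev_T_unique:
  fixes p q :: "int poly"
  assumes "\<And>z::complex. z \<noteq> 0 \<Longrightarrow>
    poly (map_poly of_int p) (z + inverse z) = poly (map_poly of_int q) (z + inverse z)"
  shows "p = q"
proof -
  have "poly (map_poly of_int p) w = poly (map_poly of_int q) w" for w :: complex
  proof -
    define z where "z = (w + csqrt (w\<^sup>2 - 4)) / 2"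
    have eq: "z * (w - z) = 1"
    proof -
      have "z * (w - z) = (w\<^sup>2 - (csqrt (w\<^sup>2 - 4))\<^sup>2) / 4"
        by (simp add: z_def field_simps power2_eq_square)
      then show ?thesis by simp
    qed
    then have "z \<noteq> 0" by auto
    moreover from this eq have "w = z + inverse z" by (simp add: field_simps)
    ultimately show ?thesis using assms by blast
  qed
  then have "map_poly of_int p = (map_poly of_int q :: complex poly)"
    by (simp add: poly_eq_poly_eq_iff fun_eq_iff flip: poly_eq_poly_eq_iff)
  then have "(of_int (coeff p i) :: complex) = of_int (coeff q i)" for i
    by (metis coeff_map_poly of_int_0)
  then show ?thesis by (simp add: poly_eq_iff)
qed

lemma chebyshev_T_exists:
  assumes "d > 0"
  shows "\<exists>p :: int poly. degree p = d \<and> lead_coeff p = 1 \<and>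
    (\<forall>z::complex. z \<noteq> 0 \<longrightarrow> poly (map_poly of_int p) (z + inverse z) = z ^ d + inverse z ^ d)"
    (is "\<exists>p. ?P d p")
proof -
  have "\<exists>p q. ?P (Suc k) p \<and> ?P (Suc (Suc k)) q" for k
  proof (induction k)
    case 0
    have "?P (Suc 0) [:0, 1:]" "?P (Suc (Suc 0)) [:-2, 0, 1:]"
      by (simp_all add: map_poly_pCons field_simps)
    then show ?case by blast
  next
    case (Suc k)
    then obtain p q where p: "?P (Suc k) p" and q: "?P (Suc (Suc k)) q" by blast
    define r where "r = pCons 0 q - p"
    have "q \<noteq> 0" using q by auto
    then have dq: "degree (pCons 0 q) = Suc (Suc (Suc k))" using q by simp
    have dr: "degree r = Suc (Suc (Suc k))"
      using dq p unfolding r_def diff_conv_add_uminus by (subst degree_add_eq_left) auto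
    have "coeff p (Suc (Suc (Suc k))) = 0" using p by (intro coeff_eq_0) simp
    moreover have "coeff q (Suc (Suc k)) = 1" using q by metis
    ultimately have lr: "lead_coeff r = 1" unfolding dr by (simp add: r_def)
    have id: "poly (map_poly of_int r) (z + inverse z) =
        z ^ Suc (Suc (Suc k)) + inverse z ^ Suc (Suc (Suc k))" if "z \<noteq> 0" for z :: complex
    proof -
      have "(map_poly of_int r :: complex poly) = pCons 0 (map_poly of_int q) - map_poly of_int p"
        by (rule poly_eqI) (simp add: r_def coeff_map_poly coeff_pCons split: nat.splits)
      then have "poly (map_poly of_int r) (z + inverse z) = (z + inverse z) *
          (z ^ Suc (Suc k) + inverse z ^ Suc (Suc k)) - (z ^ Suc k + inverse z ^ Suc k)"
        using p q that by simp
      also have "\<dots> = z ^ Suc (Suc (Suc k)) + inverse z ^ Suc (Suc (Suc k))"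
        using that by (simp add: field_simps)
      finally show ?thesis .
    qed
    show ?case using q dr lr id by (intro exI[of _ q] exI[of _ r]) auto
  qed
  from this[of "d - 1"] assms show ?thesis by auto
qed

lemma chebyshev_T_ex1:
  assumes "d > 0"
  shows "\<exists>!p :: int poly. lead_coeff p = 1 \<and>
    (\<forall>z::complex. z \<noteq> 0 \<longrightarrow> poly (map_poly of_int p) (z + inverse z) = z ^ d + inverse z ^ d)"
proof (rule ex_ex1I)
  show "\<exists>p :: int poly. lead_coeff p = 1 \<and>
    (\<forall>z::complex. z \<noteq> 0 \<longrightarrow> poly (map_poly of_int p) (z + inverse z) = z ^ d + inverse z ^ d)"
    using chebyshev_T_exists[OF assms] by blast
qed (rule chebyshev_T_unique, auto)

end

theory Submission
  imports Defs "Jordan_Normal_Form.Char_Poly"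
begin

text \<open>
  Write \<open>D(\<Phi>) = [\<O> : \<int>[\<theta>]]\<^sup>2 \<Delta>(K)\<close>, so the question is whether \<open>\<int>[\<theta>]\<close> is the maximal order.
  With \<open>d = l\<^sup>n = 2k + 1\<close>, the iterate is \<open>T\<^sub>d\<close>, and \<open>T\<^sub>d - 2 = (x - 2) R\<^sup>2\<close>, \<open>T\<^sub>d + 2 = (x + 2) S\<^sup>2\<close>,
  \<open>T\<^sub>d' = d R S\<close>. Euler's dual basis gives \<open>\<Phi>'(\<theta>) \<O> \<subseteq> \<int>[\<theta>]\<close>, hence
  \<open>d (t - 2) (t + 2) \<O> \<subseteq> \<int>[\<theta>]\<close>, and only primes dividing \<open>l (t - 2) (t + 2)\<close> matter.

  At \<open>l\<close> one has \<open>\<Phi> \<equiv> (x - t)\<^sup>d\<close>, and \<open>\<int>[\<theta>]\<close> is maximal there iff \<open>l\<^sup>2\<close> does not divide \<open>\<Phi>(t)\<close>,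
  which is congruent to \<open>T\<^sub>l(t) - t\<close> modulo \<open>l\<^sup>2\<close>. At a prime \<open>p \<noteq> l\<close> dividing \<open>t - 2\<close> one has
  \<open>\<Phi> \<equiv> (x - 2) R\<^sup>2\<close> with \<open>(x - 2) R\<close> separable modulo \<open>p\<close>. If \<open>g(\<theta>)/p\<close> is integral then
  \<open>(x - 2) R\<close> divides \<open>g\<close> modulo \<open>p\<close>; squaring and using \<open>(\<theta> - 2) R(\<theta>)\<^sup>2 = t - 2\<close> shows that the
  quotient is again divisible by \<open>R\<close> when \<open>p\<^sup>2\<close> does not divide \<open>t - 2\<close>. If \<open>m\<^sup>2\<close> divides \<open>t - 2\<close>,
  then \<open>(\<theta> - 2) R(\<theta>)/m\<close> is integral. The same holds for \<open>t + 2\<close> and \<open>S\<close>. Congruences modulo \<open>p\<close>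
  are read off from integrality of the values of a polynomial at complex roots, so no finite
  fields are needed.
\<close>

section \<open>Algebraic integers\<close>

interpretation int_module: Modules.module "\<lambda>(n::int) (x::complex). of_int n * x"
  by unfold_locales (auto simp: algebra_simps)

lemma int_span_mult_closed:
  assumes "\<And>v. v \<in> V \<Longrightarrow> x * v \<in> int_module.span V" and "u \<in> int_module.span V"
  shows "x * u \<in> int_module.span V"
  using assms(2)
proof (induction rule: int_module.span_induct_alt)
  case base
  show ?case by (simp add: int_module.span_zero)
next
  case (step c v w)
  have "x * (of_int c * v + w) = of_int c * (x * v) + x * w" by (simp add: algebra_simps)
  then show ?case using assms(1) step int_module.span_add int_module.span_scale by metis
qed

text \<open>Expanding \<open>y * v\<close> over V gives an integer matrix for which the vector
  listing V is an eigenvector with eigenvalue y; its characteristic polynomial is monic with integer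
  coefficients. The element \<open>v\<^sub>0\<close> guarantees that this vector is nonzero.\<close>

lemma algebraic_int_int_span:
  assumes "finite V" and "v\<^sub>0 \<in> V" and "v\<^sub>0 \<noteq> 0"
    and y: "\<And>v. v \<in> V \<Longrightarrow> y * v \<in> int_module.span V"
  shows "algebraic_int y"
proof -
  obtain n and f :: "nat \<Rightarrow> complex" where f: "bij_betw f {..<n} V"
    using ex_bij_betw_nat_finite[OF assms(1)] by (auto simp: atLeast0LessThan)
  have "\<exists>c. y * f i = (\<Sum>j<n. of_int (c j) * f j)" if "i < n" for i
  proof -
    have "y * f i \<in> int_module.span V" using y f that by (auto simp: bij_betw_def)
    then obtain u where "y * f i = (\<Sum>v\<in>V. of_int (u v) * v)"
      by (auto simp: int_module.span_finite[OF assms(1)])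
    also have "\<dots> = (\<Sum>j<n. of_int (u (f j)) * f j)"
      by (rule sum.reindex_bij_betw[OF f, symmetric])
    finally show ?thesis by (intro exI[of _ "\<lambda>j. u (f j)"])
  qed
  then obtain A where A: "\<And>i. i < n \<Longrightarrow> y * f i = (\<Sum>j<n. of_int (A i j) * f j)" by metis
  define M :: "int mat" where "M = mat n n (\<lambda>(i, j). A i j)"
  define Mc :: "complex mat" where "Mc = map_mat of_int M"
  have M: "M \<in> carrier_mat n n" and Mc: "Mc \<in> carrier_mat n n" by (auto simp: M_def Mc_def)
  have "eigenvector Mc (vec n f) y"
    unfolding eigenvector_def
  proof (intro conjI)
    obtain i where "i < n" "f i = v\<^sub>0" using f assms(2) by (auto simp: bij_betw_def)
    then show "vec n f \<noteq> 0\<^sub>v (dim_row Mc)"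
      using assms(3) by (metis index_vec index_zero_vec(1) carrier_matD(1) Mc)
    show "Mc *\<^sub>v vec n f = y \<cdot>\<^sub>v vec n f"
      by (rule eq_vecI) (auto simp: Mc_def M_def A scalar_prod_def atLeast0LessThan)
  qed (use Mc in auto)
  then have "eigenvalue Mc y" unfolding eigenvalue_def by blast
  then have "poly (char_poly Mc) y = 0" using eigenvalue_root_char_poly[OF Mc] by blast
  moreover have "char_poly Mc = map_poly of_int (char_poly M)"
    unfolding Mc_def by (rule of_int_hom.char_poly_hom[OF M])
  moreover have "lead_coeff (char_poly M) = 1" using degree_monic_char_poly[OF M] by simp
  ultimately show ?thesis unfolding algebraic_int_altdef_ipoly by metis
qed

lemma algebraic_int_power_eq_sum:
  fixes x :: complex
  assumes "algebraic_int x"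
  obtains m c where "m > 0" "x ^ m = (\<Sum>k<m. of_int (c k) * x ^ k)"
proof -
  obtain p where p: "poly (map_poly of_int p) x = 0" "lead_coeff p = (1::int)"
    using assms by (auto simp: algebraic_int_altdef_ipoly)
  have deg: "degree p > 0"
    using p by (intro Nat.gr0I) (auto elim!: degree_eq_zeroE)
  have "0 = (\<Sum>k\<le>degree p. of_int (coeff p k) * x ^ k)"
    using p(1) by (simp add: poly_altdef degree_map_poly coeff_map_poly)
  also have "\<dots> = (\<Sum>k<degree p. of_int (coeff p k) * x ^ k) + x ^ degree p"
    using p(2) by (simp flip: lessThan_Suc_atMost)
  finally have "x ^ degree p = (\<Sum>k<degree p. of_int (- coeff p k) * x ^ k)"
    by (simp add: sum_negf eq_neg_iff_add_eq_0 add.commute)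
  with deg show ?thesis by (rule that)
qed

lemma int_span_power_mult:
  assumes "x ^ m = (\<Sum>k<m. of_int (c k) * x ^ k)" and "i < m"
    and "\<And>k. k < m \<Longrightarrow> x ^ k * w \<in> V"
  shows "x * (x ^ i * w) \<in> int_module.span V"
proof (cases "Suc i < m")
  case True
  then show ?thesis using assms(3)[of "Suc i"] by (simp add: int_module.span_base mult.assoc)
next
  case False
  then have "m = Suc i" using assms(2) by simp
  then have "x * (x ^ i * w) = x ^ m * w" by simp
  also have "\<dots> = (\<Sum>k<m. of_int (c k) * (x ^ k * w))"
    unfolding assms(1) by (simp add: sum_distrib_right mult.assoc)
  also have "\<dots> \<in> int_module.span V"
    using assms(3) by (intro int_module.span_sum int_module.span_scale int_module.span_base) auto
  finally show ?thesis .
qed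

text \<open>V consists of the products x^i y^j w with i and j below the degrees of monic equations
  for x and y. Multiplication by z commutes with x and y, so the last clause needs testing only on
  W. Sums and products use W = {1}; roots of quadratics use W = {1, z}.\<close>

lemma algebraic_int_closure_aux:
  fixes x y :: complex
  assumes "algebraic_int x" "algebraic_int y" "finite W"
  obtains V where "finite V" "W \<subseteq> V"
    "\<And>u. u \<in> int_module.span V \<Longrightarrow> x * u \<in> int_module.span V"
    "\<And>u. u \<in> int_module.span V \<Longrightarrow> y * u \<in> int_module.span V"
    "\<And>z v. v \<in> V \<Longrightarrow> (\<And>w. w \<in> W \<Longrightarrow> z * w \<in> int_module.span V) \<Longrightarrow> z * v \<in> int_module.span V"
proof -
  obtain m c where m: "m > 0" and xm: "x ^ m = (\<Sum>k<m. of_int (c k) * x ^ k)"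
    using assms(1) by (rule algebraic_int_power_eq_sum)
  obtain n d where n: "n > 0" and yn: "y ^ n = (\<Sum>k<n. of_int (d k) * y ^ k)"
    using assms(2) by (rule algebraic_int_power_eq_sum)
  define V where "V = (\<lambda>(i, j, w). x ^ i * (y ^ j * w)) ` ({..<m} \<times> {..<n} \<times> W)"
  have V: "x ^ i * (y ^ j * w) \<in> V" if "i < m" "j < n" "w \<in> W" for i j w
    using that unfolding V_def by (intro image_eqI[of _ _ "(i, j, w)"]) auto
  have V': "y ^ j * (x ^ i * w) \<in> V" if "i < m" "j < n" "w \<in> W" for i j w
    using V[OF that] by (simp add: mult.left_commute)
  have x: "x * u \<in> int_module.span V" if "u \<in> int_module.span V" for u
  proof (rule int_span_mult_closed[OF _ that])
    fix v assume "v \<in> V"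
    then obtain i j w where "i < m" "j < n" "w \<in> W" "v = x ^ i * (y ^ j * w)"
      by (auto simp: V_def)
    then show "x * v \<in> int_module.span V" using int_span_power_mult[OF xm] V by metis
  qed
  have y: "y * u \<in> int_module.span V" if "u \<in> int_module.span V" for u
  proof (rule int_span_mult_closed[OF _ that])
    fix v assume "v \<in> V"
    then obtain i j w where "i < m" "j < n" "w \<in> W" "v = y ^ j * (x ^ i * w)"
      by (auto simp: V_def mult.left_commute)
    then show "y * v \<in> int_module.span V" using int_span_power_mult[OF yn] V' by metis
  qed
  have z: "z * v \<in> int_module.span V" if v: "v \<in> V" and zw: "\<And>w. w \<in> W \<Longrightarrow> z * w \<in> int_module.span V" for z v
  proof -
    obtain i j w where w: "w \<in> W" "v = x ^ i * (y ^ j * w)"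
      using v by (auto simp: V_def)
    have "y ^ j * (z * w) \<in> int_module.span V" for j
      by (induction j) (use y zw w(1) in \<open>auto simp: mult.assoc\<close>)
    then have "x ^ i * (y ^ j * (z * w)) \<in> int_module.span V" for i j
      by (induction i) (use x in \<open>auto simp: mult.assoc\<close>)
    then show ?thesis by (simp add: w(2) mult.left_commute)
  qed
  have "w \<in> V" if "w \<in> W" for w using V[OF m n that] by simp
  moreover have "finite V" using assms(3) by (simp add: V_def)
  ultimately show ?thesis using x y z by (intro that[of V]) auto
qed

lemma algebraic_int_add [intro]:
  fixes x y :: complex
  assumes "algebraic_int x" "algebraic_int y"
  shows "algebraic_int (x + y)"
proof -
  obtain V where V: "finite V" "{1} \<subseteq> V"
    "\<And>u. u \<in> int_module.span V \<Longrightarrow> x * u \<in> int_module.span V"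
    "\<And>u. u \<in> int_module.span V \<Longrightarrow> y * u \<in> int_module.span V"
    using algebraic_int_closure_aux[OF assms, of "{1}"] by (metis finite.emptyI finite.insertI)
  show ?thesis
    using V by (intro algebraic_int_int_span[of V 1])
      (auto simp: distrib_right intro!: int_module.span_add intro: int_module.span_base)
qed

lemma algebraic_int_mult [intro]:
  fixes x y :: complex
  assumes "algebraic_int x" "algebraic_int y"
  shows "algebraic_int (x * y)"
proof -
  obtain V where V: "finite V" "{1} \<subseteq> V"
    "\<And>u. u \<in> int_module.span V \<Longrightarrow> x * u \<in> int_module.span V"
    "\<And>u. u \<in> int_module.span V \<Longrightarrow> y * u \<in> int_module.span V"
    using algebraic_int_closure_aux[OF assms, of "{1}"] by (metis finite.emptyI finite.insertI)
  show ?thesis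
    using V by (intro algebraic_int_int_span[of V 1])
      (auto simp: mult.assoc intro: int_module.span_base)
qed

text \<open>Integrality is transitive: the span of x^i y^j and x^i y^j z, for x = b and y = c, is
  stable under z because z^2 reduces to b z + c.\<close>

lemma algebraic_int_quadratic:
  fixes b c z :: complex
  assumes "algebraic_int b" "algebraic_int c" and z: "z\<^sup>2 = b * z + c"
  shows "algebraic_int z"
proof -
  obtain V where V: "finite V" "{1, z} \<subseteq> V"
    "\<And>u. u \<in> int_module.span V \<Longrightarrow> b * u \<in> int_module.span V"
    "\<And>u. u \<in> int_module.span V \<Longrightarrow> c * u \<in> int_module.span V"
    "\<And>y v. v \<in> V \<Longrightarrow> (\<And>w. w \<in> {1, z} \<Longrightarrow> y * w \<in> int_module.span V) \<Longrightarrow> y * v \<in> int_module.span V"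
    using algebraic_int_closure_aux[OF assms(1,2), of "{1, z}"] by (metis finite.emptyI finite.insertI)
  have "z * z \<in> int_module.span V"
    unfolding power2_eq_square[symmetric] z
    using V(2) V(3)[of z] V(4)[of 1] by (intro int_module.span_add) (auto intro: int_module.span_base)
  moreover have "z \<in> int_module.span V" using V(2) by (auto intro: int_module.span_base)
  ultimately have "z * v \<in> int_module.span V" if "v \<in> V" for v
    by (intro V(5)[OF that]) auto
  then show ?thesis
    using V(1,2) by (intro algebraic_int_int_span[of V 1]) auto
qed

lemma algebraic_int_diff [intro]:
  "algebraic_int x \<Longrightarrow> algebraic_int y \<Longrightarrow> algebraic_int (x - y :: complex)"
  using algebraic_int_add[of x "- y"] by simp

lemma algebraic_int_power [intro]: "algebraic_int x \<Longrightarrow> algebraic_int (x ^ n :: complex)"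
  by (induction n) auto

lemma algebraic_int_sum [intro]:
  "(\<And>i. i \<in> A \<Longrightarrow> algebraic_int (f i :: complex)) \<Longrightarrow> algebraic_int (\<Sum>i\<in>A. f i)"
  by (induction A rule: infinite_finite_induct) auto

lemma algebraic_int_prod [intro]:
  "(\<And>i. i \<in> A \<Longrightarrow> algebraic_int (f i :: complex)) \<Longrightarrow> algebraic_int (\<Prod>i\<in>A. f i)"
  by (induction A rule: infinite_finite_induct) auto

lemma algebraic_int_poly [intro]:
  assumes "algebraic_int x" "\<And>i. algebraic_int (coeff p i)"
  shows "algebraic_int (poly p x :: complex)"
  using assms unfolding poly_altdef by auto

lemma algebraic_int_poly_of_int [intro]:
  "algebraic_int x \<Longrightarrow> algebraic_int (poly (map_poly of_int p) x :: complex)"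
  by (rule algebraic_int_poly) (auto simp: coeff_map_poly)

lemma coeff_mult_algebraic_int:
  assumes "\<And>i. algebraic_int (coeff p i)" "\<And>i. algebraic_int (coeff q i)"
  shows "algebraic_int (coeff (p * q) i :: complex)"
  using assms unfolding coeff_mult by auto

lemma coeff_prod_algebraic_int:
  assumes "\<And>a i. a \<in> A \<Longrightarrow> algebraic_int (coeff (f a) i)"
  shows "algebraic_int (coeff (\<Prod>a\<in>A. f a) i :: complex)"
  using assms
proof (induction A arbitrary: i rule: infinite_finite_induct)
  case (insert a A)
  then show ?case by (auto intro!: coeff_mult_algebraic_int)
qed (auto simp: coeff_1)

section \<open>Interpolation at the roots of a monic integer polynomial\<close>

abbreviation ipoly :: "int poly \<Rightarrow> complex \<Rightarrow> complex" where
  "ipoly p x \<equiv> poly (of_int_poly p) x"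

lemma monic_int_division:
  fixes P F :: "int poly"
  assumes "lead_coeff F = 1"
  obtains Q H where "P = F * Q + H" "H = 0 \<or> degree H < degree F"
proof -
  have "F \<noteq> 0" using assms by auto
  \<comment> \<open>Pseudo-division scales P by a power of the leading coefficient of F, which is 1
    here.\<close>
  moreover obtain Q H where QH: "pseudo_divmod P F = (Q, H)" by fastforce
  ultimately show ?thesis
    using pseudo_divmod[of F P Q H] assms that[of Q H] by simp
qed

lemma monic_multiple_eq_0:
  fixes F :: "'a::idom poly"
  assumes "H = F * Q" "degree H < degree F \<or> H = 0"
  shows "H = 0"
proof (rule ccontr)
  assume "H \<noteq> 0"
  then have "degree H = degree F + degree Q" using assms(1) by (auto simp: degree_mult_eq)
  then show False using assms(2) \<open>H \<noteq> 0\<close> by simp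
qed

lemma algebraic_int_root_of_monic:
  "lead_coeff F = 1 \<Longrightarrow> ipoly F a = 0 \<Longrightarrow> algebraic_int a"
  unfolding algebraic_int_altdef_ipoly by blast

text \<open>Euler's formula: the remainder is the interpolation polynomial
  \<open>\<Sum>\<^sub>a s g(a) F(X) / (X - a)\<close>, summed over the roots \<open>a\<close> of \<open>F\<close>.\<close>

lemma euler_interpolation:
  fixes F g Q H :: "int poly" and s :: complex
  assumes monic: "lead_coeff F = 1" and sq: "rsquarefree (of_int_poly F :: complex poly)"
    and div: "g * pderiv F = F * Q + H" "H = 0 \<or> degree H < degree F"
    and int: "\<And>a. ipoly F a = 0 \<Longrightarrow> algebraic_int (s * ipoly g a)"
  shows "algebraic_int (s * of_int (coeff H i))"
proof (cases "degree F = 0")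
  case True
  then show ?thesis using div(2) by auto
next
  case False
  define A where "A = {a. ipoly F a = 0}"
  let ?F = "of_int_poly F :: complex poly"
  have F0: "?F \<noteq> 0" using sq by (auto simp: rsquarefree_def)
  have fin: "finite A" unfolding A_def using F0 by (rule poly_roots_finite)
  have card: "card A = degree F"
    using rsquarefree_card_degree[OF F0] sq by (simp add: A_def)
  have Fprod: "?F = (\<Prod>a\<in>A. [:- a, 1:])"
    using complex_poly_decompose_rsquarefree[OF sq] monic by (simp add: A_def)
  define G where "G = (\<Sum>a\<in>A. smult (s * ipoly g a) (\<Prod>b\<in>A - {a}. [:- b, 1:]))"
  have deriv: "poly (pderiv ?F) a = (\<Prod>b\<in>A - {a}. a - b)" if "a \<in> A" for a
  proof -
    have "poly (pderiv ?F) a = (\<Sum>c\<in>A. \<Prod>b\<in>A - {c}. a - b)"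
      unfolding Fprod pderiv_prod by (simp add: poly_sum poly_prod pderiv_pCons)
    also have "\<dots> = (\<Sum>c\<in>{a}. \<Prod>b\<in>A - {c}. a - b)"
      using fin that by (intro sum.mono_neutral_right) (auto intro!: prod_zero)
    finally show ?thesis by simp
  qed
  have G_eval: "poly G a = s * ipoly g a * (\<Prod>b\<in>A - {a}. a - b)" if "a \<in> A" for a
  proof -
    have "poly G a = (\<Sum>c\<in>A. s * ipoly g c * (\<Prod>b\<in>A - {c}. a - b))"
      by (simp add: G_def poly_sum poly_prod)
    also have "\<dots> = (\<Sum>c\<in>{a}. s * ipoly g c * (\<Prod>b\<in>A - {c}. a - b))"
      using fin that by (intro sum.mono_neutral_right) (auto intro!: prod_zero)
    finally show ?thesis by simp
  qed
  \<comment> \<open>Both sides have degree below the number of roots, and at a root a the division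
    gives g(a) F'(a) = H(a), since F(a) = 0.\<close>
  have "smult s (of_int_poly H) = G"
  proof (rule poly_eqI_degree[of A])
    fix a assume a: "a \<in> A"
    have "ipoly (g * pderiv F) a = ipoly (F * Q + H) a" by (simp only: div(1))
    then have "ipoly g a * poly (pderiv ?F) a = ipoly H a"
      using a by (simp add: A_def of_int_poly_hom.hom_mult of_int_poly_hom.hom_add
          of_int_hom.map_poly_pderiv)
    then show "poly (smult s (of_int_poly H)) a = poly G a"
      by (simp add: G_eval[OF a] deriv[OF a] mult.assoc)
  next
    show "degree (smult s (of_int_poly H) :: complex poly) < card A"
      using div(2) False card by (auto intro: le_less_trans[OF degree_smult_le])
    have "degree G \<le> card A - 1"
      unfolding G_def
    proof (intro degree_sum_le fin order_trans[OF degree_smult_le])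
      fix a assume "a \<in> A"
      then show "degree (\<Prod>b\<in>A - {a}. [:- b, 1:]) \<le> card A - 1"
        using fin degree_prod_sum_le[of "A - {a}" "\<lambda>b. [:- b, 1:]"] by simp
    qed
    then show "degree G < card A" using card False by simp
  qed
  moreover have "algebraic_int (coeff G i)"
    unfolding G_def coeff_sum coeff_smult
  proof (intro algebraic_int_sum algebraic_int_mult[OF int coeff_prod_algebraic_int])
    fix a b j assume "a \<in> A" "b \<in> A - {a}"
    then show "algebraic_int (coeff [:- b, 1:] j)"
      using algebraic_int_root_of_monic[OF monic] by (auto simp: A_def coeff_pCons split: nat.splits)
  qed (simp add: A_def)
  ultimately show ?thesis by (metis coeff_smult of_int_hom.coeff_map_poly_hom)
qed

lemma dvd_if_algebraic_int_divide:
  fixes c p :: int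
  assumes "algebraic_int (of_int c / of_int p :: complex)" "p \<noteq> 0"
  shows "p dvd c"
proof -
  have "of_int c / of_int p \<in> (\<int> :: complex set)"
    using rational_algebraic_int_is_int[OF assms(1)] by auto
  then obtain k where "of_int c / of_int p = (of_int k :: complex)" by (auto elim: Ints_cases)
  then have "(of_int c :: complex) = of_int (k * p)" using assms(2) by (simp add: field_simps)
  then have "c = k * p" by (simp only: of_int_eq_iff)
  then show ?thesis by simp
qed

lemma const_dvd_poly_obtain:
  fixes p :: "'a::idom"
  assumes "\<And>i. p dvd coeff H i"
  obtains H' where "H = smult p H'"
  using assms const_poly_dvd_iff[of p H] by (auto elim!: dvdE)

text \<open>The codifferent bound: \<open>F'(a) \<cdot> g(a) / m\<close> lies in \<open>\<int>[a]\<close> whenever \<open>g(a) / m\<close> is integral.\<close>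

lemma euler_dual:
  fixes F g :: "int poly" and m :: int
  assumes "lead_coeff F = 1" "rsquarefree (of_int_poly F :: complex poly)" "m \<noteq> 0"
    and int: "\<And>a. ipoly F a = 0 \<Longrightarrow> algebraic_int (ipoly g a / of_int m)"
  obtains h Q where "g * pderiv F = F * Q + smult m h"
proof -
  obtain Q H where QH: "g * pderiv F = F * Q + H" "H = 0 \<or> degree H < degree F"
    using monic_int_division[OF assms(1)] by blast
  have "m dvd coeff H i" for i
  proof (rule dvd_if_algebraic_int_divide[OF _ assms(3)])
    show "algebraic_int (of_int (coeff H i) / of_int m :: complex)"
      using euler_interpolation[OF assms(1,2) QH, of "1 / of_int m"] int by simp
  qed
  then obtain h where "H = smult m h" by (metis const_dvd_poly_obtain)
  with QH show ?thesis by (intro that[of Q h]) simp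
qed

text \<open>Modulo \<open>p\<close> the polynomial \<open>F\<close> is separable, hence radical. Divisibility of \<open>w\<close> by \<open>F\<close> is
  detected by Euler's formula applied to \<open>w(a) / p\<^bsup>1/k\<^esup>\<close>.\<close>

lemma separable_mod_dvd:
  fixes F w A B :: "int poly" and p e :: int and k :: nat
  assumes "lead_coeff F = 1" and p: "prime p" and k: "k > 0"
    and bezout: "A * F + B * pderiv F = [:e:]" "coprime e p"
    and int: "\<And>a. ipoly F a = 0 \<Longrightarrow> algebraic_int (ipoly w a ^ k / of_int p)"
  obtains Q H where "w = F * Q + smult p H"
proof -
  have "e \<noteq> 0" using bezout(2) p by auto
  \<comment> \<open>As e is nonzero, the Bezout relation also excludes a common complex root of F
    and F'.\<close>
  have sq: "rsquarefree (of_int_poly F :: complex poly)"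
    unfolding rsquarefree_roots
  proof (intro allI notI)
    fix a assume a: "ipoly F a = 0 \<and> poly (pderiv (of_int_poly F)) a = 0"
    have "ipoly (A * F + B * pderiv F) a = ipoly [:e:] a" by (simp only: bezout(1))
    then show False
      using a \<open>e \<noteq> 0\<close>
      by (simp add: of_int_poly_hom.hom_mult of_int_poly_hom.hom_add of_int_hom.map_poly_pderiv)
  qed
  obtain Q H where QH: "w * pderiv F = F * Q + H" "H = 0 \<or> degree H < degree F"
    using monic_int_division[OF assms(1)] by blast
  have "p > 0" using p by (simp add: prime_gt_0_int)
  \<comment> \<open>The factor s is p^(-1/k); s w(a) is integral because its k-th power is. At the
    end the k-th power of s times a coefficient is a rational number with denominator p, to which
    integrality can be applied.\<close>
  define s :: complex where "s = of_real (1 / root k (of_int p))"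
  have sk: "s ^ k = 1 / of_int p"
  proof -
    have "(1 / root k (real_of_int p)) ^ k = 1 / of_int p"
      using \<open>p > 0\<close> k by (simp add: power_divide)
    then have "s ^ k = of_real (1 / of_int p)" unfolding s_def of_real_power[symmetric] by simp
    then show ?thesis by simp
  qed
  have root: "algebraic_int x" if "algebraic_int (x ^ k)" for x :: complex
    using that k
    by (intro algebraic_int_root[OF that, of "monom 1 k"])
      (auto simp: poly_monom degree_monom_eq coeff_monom)
  have "p dvd coeff H i" for i
  proof -
    have "algebraic_int (s * of_int (coeff H i))"
    proof (rule euler_interpolation[OF assms(1) sq QH])
      fix a assume "ipoly F a = 0"
      then have "algebraic_int ((s * ipoly w a) ^ k)"
        using int by (simp add: power_mult_distrib sk)
      then show "algebraic_int (s * ipoly w a)" by (rule root)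
    qed
    then have "algebraic_int ((s * of_int (coeff H i)) ^ k)" by blast
    then have "algebraic_int (of_int (coeff H i ^ k) / of_int p :: complex)"
      by (simp add: power_mult_distrib sk)
    then have "p dvd coeff H i ^ k"
      by (rule dvd_if_algebraic_int_divide) (use \<open>p > 0\<close> in simp)
    then show ?thesis using p by (auto dest: prime_dvd_power)
  qed
  then obtain h where h: "H = smult p h" by (metis const_dvd_poly_obtain)
  obtain u v where uv: "u * e + v * p = 1"
    using bezout_int[of e p] bezout(2) by (auto simp: coprime_iff_gcd_eq_1)
  \<comment> \<open>Multiplying the Bezout relation by w and replacing w F' by its remainder p h
    makes e w a multiple of F modulo p; then e is inverted modulo p.\<close>
  have "[:e:] * w = F * (A * w + B * Q) + smult p (B * h)"
    unfolding bezout(1)[symmetric] using QH(1) h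
    by (simp add: algebra_simps)
  then have ew: "smult e w = F * (A * w + B * Q) + smult p (B * h)" by simp
  have "w = smult (u * e + v * p) w" by (simp add: uv)
  also have "\<dots> = smult u (smult e w) + smult p (smult v w)"
    by (simp add: smult_add_left mult.commute[of v])
  also have "\<dots> = F * smult u (A * w + B * Q) + smult p (smult u (B * h) + smult v w)"
    unfolding ew by (simp add: smult_add_right distrib_left mult.commute[of u])
  finally show ?thesis by (rule that)
qed

section \<open>Chebyshev polynomials\<close>

lemmas of_int_poly_simps = of_int_poly_hom.hom_mult of_int_poly_hom.hom_add of_int_poly_hom.hom_minus
  of_int_poly_hom.hom_power of_int_hom.map_poly_pderiv of_int_hom.map_poly_hom_smult of_int_hom.map_poly_pCons_hom

lemma chebyshev_T_monic:
  assumes "d > 0"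
  shows "lead_coeff (chebyshev_T d) = 1"
    and "z \<noteq> 0 \<Longrightarrow> ipoly (chebyshev_T d) (z + inverse z) = z ^ d + inverse z ^ d"
  using theI'[OF chebyshev_T_ex1[OF assms]] unfolding chebyshev_T_def by auto

lemma chebyshev_T_eqI:
  assumes "d > 0" "\<And>z. z \<noteq> 0 \<Longrightarrow> ipoly p (z + inverse z) = z ^ d + inverse z ^ d"
  shows "chebyshev_T d = p"
  by (rule chebyshev_T_unique) (simp add: assms chebyshev_T_monic(2))

lemma degree_chebyshev_T:
  assumes "d > 0"
  shows "degree (chebyshev_T d) = d"
  using chebyshev_T_exists[OF assms] chebyshev_T_eqI[OF assms] by metis

lemma chebyshev_T_pcompose:
  assumes "a > 0" "b > 0"
  shows "pcompose (chebyshev_T a) (chebyshev_T b) = chebyshev_T (a * b)"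
proof (rule chebyshev_T_eqI[symmetric])
  fix z :: complex assume "z \<noteq> 0"
  then show "ipoly (pcompose (chebyshev_T a) (chebyshev_T b)) (z + inverse z) = z ^ (a * b) + inverse z ^ (a * b)"
    using chebyshev_T_monic(2)[OF assms(1), of "z ^ b"] chebyshev_T_monic(2)[OF assms(2)]
    by (simp add: of_int_hom.map_poly_pcompose poly_pcompose power_inverse mult.commute[of a] power_mult)
qed (use assms in simp)

lemma chebyshev_T_iter_eq:
  assumes "l > 0"
  shows "chebyshev_T_iter l n = chebyshev_T (l ^ n)"
proof (induction n)
  case 0
  have "chebyshev_T 1 = [:0, 1:]" by (rule chebyshev_T_eqI) auto
  then show ?case by (simp add: chebyshev_T_iter_def)
next
  case (Suc n)
  then show ?case using assms chebyshev_T_pcompose[of l "l ^ n"] by (simp add: chebyshev_T_iter_def)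
qed

text \<open>For odd \<open>d = 2m + 1\<close> and \<open>e = \<plusminus>1\<close>, the polynomial \<open>T\<^sub>d - 2e\<close> is \<open>x - 2e\<close> times the square of
  the following polynomial.\<close>

fun cheb_half :: "int \<Rightarrow> nat \<Rightarrow> int poly" where
  "cheb_half e 0 = 1"
| "cheb_half e (Suc 0) = [:e, 1:]"
| "cheb_half e (Suc (Suc m)) = [:0, 1:] * cheb_half e (Suc m) - cheb_half e m"

lemma cheb_half_monic: "degree (cheb_half e m) = m \<and> lead_coeff (cheb_half e m) = 1"
proof (induction e m rule: cheb_half.induct)
  case (3 e m)
  let ?p = "cheb_half e (Suc m)" and ?q = "cheb_half e m"
  have deg: "degree ([:0, 1:] * ?p) = Suc (Suc m)"
    using 3 by (subst degree_mult_eq) auto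
  then have "degree (cheb_half e (Suc (Suc m))) = Suc (Suc m)"
    using 3 unfolding cheb_half.simps diff_conv_add_uminus by (subst degree_add_eq_left) auto
  moreover have "coeff ?q (Suc (Suc m)) = 0" using 3 by (intro coeff_eq_0) auto
  moreover have "coeff ?p (Suc m) = 1" using 3 by metis
  ultimately show ?case by simp
qed auto

text \<open>For e = 1 this identifies the polynomial as the sum of z^j over -m <= j <= m, a
  Dirichlet kernel. The denominator is cleared so that z = e needs no separate treatment.\<close>

lemma cheb_half_eval:
  assumes "e * e = 1" "z \<noteq> 0"
  shows "ipoly (cheb_half e m) (z + inverse z) * ((z - of_int e) * z ^ m) = z ^ (2 * m + 1) - of_int e"
  using assms(1)
proof (induction e m rule: cheb_half.induct)
  case (1 e)
  then show ?case by simp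
next
  case (2 e)
  then have "of_int e * of_int e = (1 :: complex)" by (simp flip: of_int_mult)
  then show ?case using assms(2) by (simp add: field_simps power3_eq_cube)
next
  case (3 e m)
  let ?x = "z + inverse z" and ?e = "of_int e :: complex"
  have "ipoly (cheb_half e (Suc (Suc m))) ?x * ((z - ?e) * z ^ Suc (Suc m))
    = (z\<^sup>2 + 1) * (ipoly (cheb_half e (Suc m)) ?x * ((z - ?e) * z ^ Suc m))
      - z\<^sup>2 * (ipoly (cheb_half e m) ?x * ((z - ?e) * z ^ m))"
  proof -
    let ?p = "ipoly (cheb_half e (Suc m)) ?x" and ?q = "ipoly (cheb_half e m) ?x"
    have "ipoly (cheb_half e (Suc (Suc m))) ?x = ?x * ?p - ?q"
      by (simp add: of_int_poly_simps)
    moreover have "?x * z = z\<^sup>2 + 1" using assms(2) by (simp add: field_simps power2_eq_square)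
    moreover have "(x * p - q) * ((z - e) * (z * (z * y)))
      = (x * z) * (p * ((z - e) * (z * y))) - z\<^sup>2 * (q * ((z - e) * y))" for x y p q e
      by (simp add: algebra_simps power2_eq_square)
    ultimately show ?thesis by simp
  qed
  also have "\<dots> = z ^ (2 * Suc (Suc m) + 1) - ?e"
    unfolding 3(1)[OF 3(3)] 3(2)[OF 3(3)] by (simp add: algebra_simps power2_eq_square)
  finally show ?case .
qed

text \<open>With x = z + 1/z and e^2 = 1 one has x - 2e = (z - e)^2 / z, so by
  \<open>cheb_half_eval\<close> the first summand becomes (z^d - e)^2 / z^d = z^d + z^(-d) - 2e for
  d = 2m + 1.\<close>

lemma chebyshev_T_odd:
  assumes "e * e = 1"
  shows "chebyshev_T (2 * m + 1) = [:- 2 * e, 1:] * (cheb_half e m)\<^sup>2 + [:2 * e:]"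
proof (rule chebyshev_T_eqI)
  fix z :: complex assume z: "z \<noteq> 0"
  let ?e = "of_int e :: complex"
  have e: "?e * ?e = 1" using assms by (simp flip: of_int_mult)
  let ?w = "ipoly (cheb_half e m) (z + inverse z)"
  have "(z + inverse z - 2 * ?e) * z = (z - ?e)\<^sup>2"
    using z e by (simp add: field_simps power2_eq_square)
  then have "(z + inverse z - 2 * ?e) * ?w\<^sup>2 * z ^ (2 * m + 1) = (?w * ((z - ?e) * z ^ m))\<^sup>2"
    by (simp add: power_mult_distrib power_mult[symmetric] mult_ac flip: power_mult)
  also have "\<dots> = (z ^ (2 * m + 1) - ?e)\<^sup>2" using cheb_half_eval[OF assms z] by simp
  also have "\<dots> = (z ^ (2 * m + 1) + inverse z ^ (2 * m + 1) - 2 * ?e) * z ^ (2 * m + 1)"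
  proof -
    have "inverse z ^ k * z ^ k = 1" for k
      using z by (simp add: power_inverse)
    moreover have "(Z - c)\<^sup>2 = (Z + I - 2 * c) * Z + (c * c - I * Z)" for Z I c :: complex
      by (simp add: power2_eq_square algebra_simps)
    ultimately show ?thesis using e by (metis add.right_neutral diff_self)
  qed
  finally have "(z + inverse z - 2 * ?e) * ?w\<^sup>2 = z ^ (2 * m + 1) + inverse z ^ (2 * m + 1) - 2 * ?e"
    using z by simp
  then show "ipoly ([:- 2 * e, 1:] * (cheb_half e m)\<^sup>2 + [:2 * e:]) (z + inverse z)
    = z ^ (2 * m + 1) + inverse z ^ (2 * m + 1)"
    by (simp add: of_int_poly_simps left_diff_distrib)
qed simp

section \<open>Derivatives and separability of the half-degree factors\<close>

context
  fixes e :: int and X E :: "int poly"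
  assumes e: "e * e = 1"
  defines "X \<equiv> [:0, 1:]" and "E \<equiv> [:e:]"
begin

text \<open>Treating the variable and the constant polynomial e as atoms X and E leaves E * E = 1 as
  the only relation beyond ring normalisation.\<close>

lemma cheb_half_E: "E * E = 1" "E * (E * p) = p"
  using e by (simp_all add: E_def one_pCons)

lemma cheb_half_linear: "[:- 2 * e, 1:] = X - 2 * E"
  by (simp add: X_def E_def numeral_poly)

lemma cheb_half_unfold:
  "cheb_half e (Suc 0) = X + E" "cheb_half (- e) (Suc 0) = X - E"
  "cheb_half c (Suc (Suc m)) = X * cheb_half c (Suc m) - cheb_half c m"
  by (simp_all add: X_def E_def)

text \<open>Both sides satisfy the same three-term recursion in m, so m = 0 and m = 1 decide. The
  identity links the two signs in the induction for \<open>pderiv_cheb_half\<close>.\<close>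

lemma cheb_half_diff:
  "cheb_half (- e) (Suc (Suc m)) - cheb_half (- e) m = [:- 2 * e, 1:] * cheb_half e (Suc m)"
proof (induction m rule: less_induct)
  case (less m)
  consider "m = 0" | "m = 1" | k where "m = Suc (Suc k)" by (metis One_nat_def not0_implies_Suc)
  then show ?case
  proof cases
    case 1
    show ?thesis
      unfolding 1 cheb_half_unfold cheb_half_linear cheb_half.simps(1) by (simp add: algebra_simps cheb_half_E)
  next
    case 2
    show ?thesis
      unfolding 2 One_nat_def cheb_half_unfold cheb_half_linear cheb_half.simps(1)
      by (simp add: algebra_simps cheb_half_E)
  next
    case 3
    let ?s = "cheb_half (- e)" and ?r = "cheb_half e" and ?L = "[:- 2 * e, 1:]"
    have m: "?s m = X * ?s (Suc k) - ?s k" unfolding 3 by (rule cheb_half_unfold(3))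
    have "(X * a - b) - (X * c - d) = X * (a - c) - (b - d)" for a b c d
      by (simp add: algebra_simps)
    then have "?s (Suc (Suc m)) - ?s m = X * (?s (Suc m) - ?s (Suc k)) - (?s m - ?s k)"
      unfolding cheb_half_unfold(3)[of _ m] by (metis m)
    also have "\<dots> = X * (?L * ?r m) - ?L * ?r (Suc k)"
      using less[of k] less[of "Suc k"] unfolding 3 by simp
    also have "\<dots> = ?L * ?r (Suc m)"
      unfolding 3 cheb_half_unfold(3)[of _ "Suc k"] by (simp only: algebra_simps)
    finally show ?thesis .
  qed
qed

text \<open>This is what T_d' = d R S becomes after differentiating T_d = (x - 2e) R^2 + 2e and
  cancelling R, with d = 2m + 1. It is proved first, by two-step induction, and yields the formula
  for T_d'.\<close>

lemma pderiv_cheb_half: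
  "smult (2 * int m + 1) (cheb_half (- e) m) = cheb_half e m + 2 * [:- 2 * e, 1:] * pderiv (cheb_half e m)"
proof (induction m rule: less_induct)
  case (less m)
  have dX: "pderiv X = 1" by (simp add: X_def pderiv_pCons)
  have dE: "pderiv E = 0" by (simp add: E_def)
  have smult_eq: "smult c p = of_int c * p" for c and p :: "int poly"
    by (simp add: of_int_poly)
  consider "m = 0" | "m = 1" | k where "m = Suc (Suc k)" by (metis One_nat_def not0_implies_Suc)
  then show ?case
  proof cases
    case 1
    then show ?thesis by simp
  next
    case 2
    show ?thesis
      unfolding 2 One_nat_def cheb_half_unfold cheb_half_linear pderiv_add dX dE smult_eq by simp
  next
    case 3
    have IH: "of_int (2 * int k + 1) * cheb_half (- e) k
        = cheb_half e k + 2 * (X - 2 * E) * pderiv (cheb_half e k)"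
      "of_int (2 * int (Suc k) + 1) * cheb_half (- e) (Suc k)
        = cheb_half e (Suc k) + 2 * (X - 2 * E) * pderiv (cheb_half e (Suc k))"
      using less[of k] less[of "Suc k"] 3 unfolding cheb_half_linear smult_eq by auto
    define c :: "int poly" where "c = of_int (2 * int k + 1)"
    have c: "of_int (2 * int (Suc k) + 1) = c + 2" "of_int (2 * int (Suc (Suc k)) + 1) = c + 4"
      by (simp_all add: c_def algebra_simps)
    \<comment> \<open>The induction step as a ring identity: c, c + 2 and c + 4 are the odd factors
      at k, k + 1 and k + 2, and the third premise is \<open>cheb_half_diff\<close>, which absorbs
      the increments of 2 and 4.\<close>
    have comb: "(c + 4) * (X * s1 - s0) = X * r1 - r0 + 2 * L * (X * r1' + r1 * 1 - r0')"
      if "c * s0 = r0 + 2 * L * r0'" "(c + 2) * s1 = r1 + 2 * L * r1'" "X * s1 - s0 - s0 = L * r1"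
      for s0 s1 r0 r1 r0' r1' L
    proof -
      have "X * r1 - r0 + 2 * L * (X * r1' + r1 * 1 - r0')
        = X * (r1 + 2 * L * r1') - (r0 + 2 * L * r0') + 2 * (L * r1)"
        by (simp add: algebra_simps)
      also have "\<dots> = (c + 4) * (X * s1 - s0)"
        unfolding that[symmetric] by (simp add: algebra_simps)
      finally show ?thesis by simp
    qed
    show ?thesis
      unfolding 3 c smult_eq cheb_half_linear cheb_half_unfold(3) pderiv_diff pderiv_mult dX
      by (rule comb)
        (use IH cheb_half_diff[of k] in \<open>simp_all only: c c_def[symmetric] cheb_half_linear cheb_half_unfold(3)\<close>)
  qed
qed

lemma pderiv_chebyshev_T:
  "pderiv (chebyshev_T (2 * m + 1)) = smult (2 * int m + 1) (cheb_half e m * cheb_half (- e) m)"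
proof -
  let ?w = "cheb_half e m"
  have "pderiv (chebyshev_T (2 * m + 1)) = ?w * (?w + 2 * [:- 2 * e, 1:] * pderiv ?w)"
  proof -
    have "pderiv [:- 2 * e, 1:] = 1" "pderiv [:2 * e:] = 0" by (simp_all add: pderiv_pCons)
    moreover have "L * (w * w' + w * w') + w * w * 1 + 0 = w * (w + 2 * L * w')" for L w w' :: "int poly"
      by (simp add: algebra_simps)
    ultimately show ?thesis
      unfolding chebyshev_T_odd[OF e] power2_eq_square pderiv_add pderiv_mult by metis
  qed
  then show ?thesis unfolding pderiv_cheb_half[symmetric] by simp
qed

end

lemma pderiv_linear_mult: "pderiv ([:c, 1:] * p) = p + [:c, 1:] * pderiv p" for p :: "'a::idom poly"
  by (simp only: pderiv_mult) (simp add: pderiv_pCons)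

text \<open>The resultant of \<open>F\<close> and \<open>F'\<close> is a power of \<open>d\<close>, so \<open>F = (x - 2e) R\<close> stays separable modulo
  every prime not dividing \<open>d\<close>.\<close>

lemma cheb_half_bezout:
  fixes e :: int and k :: nat
  assumes e: "e * e = 1"
  defines "F \<equiv> [:- 2 * e, 1:] * cheb_half e k"
  obtains A B where "A * F + B * pderiv F = [:(2 * int k + 1)\<^sup>2:]"
proof -
  define L where "L = [:- 2 * e, 1:]"
  define E where "E = [:e:]"
  define D :: "int poly" where "D = of_int (2 * int k + 1)"
  \<comment> \<open>Since d = 2k + 1 is odd, (d^2 - 1) / 4 = k (k + 1) is an integer; this allows
    the factor 4 to be cancelled at the end over the integers.\<close>
  define M :: "int poly" where "M = of_int (int k * (int k + 1))"
  define r where "r = cheb_half e k"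
  define s where "s = cheb_half (- e) k"
  define r' where "r' = pderiv r"
  have E: "E * E = 1" "E * (E * p) = p" for p using e by (simp_all add: E_def one_pCons)
  have M: "4 * M = D * D - 1" by (simp add: M_def D_def algebra_simps)
  have L': "[:- 2 * - e, 1:] = L + 4 * E" by (simp add: L_def E_def numeral_poly)
  have e2: "[:2 * e:] = 2 * E" "[:2 * - e:] = - 2 * E" by (simp_all add: E_def numeral_poly)
  \<comment> \<open>Both sides equal T_d, factored at 2e and at -2e. After scaling by d^2, the
    factor d s is replaced by r + 2 L r', so that only r and its derivative remain; multiplying by E
    turns the right side 4 E d^2 into 4 d^2.\<close>
  have "L * (r * r) + 2 * E = (L + 4 * E) * (s * s) - 2 * E"
    using chebyshev_T_odd[of e k] chebyshev_T_odd[of "- e" k] e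
    unfolding L' e2 power2_eq_square r_def[symmetric] s_def[symmetric] L_def[symmetric] by simp
  then have "(L + 4 * E) * (s * s) - L * (r * r) = 4 * E" by (simp add: algebra_simps)
  then have "D * D * ((L + 4 * E) * (s * s) - L * (r * r)) = D * D * (4 * E)" by simp
  then have "(L + 4 * E) * ((D * s) * (D * s)) - D * D * (L * (r * r)) = 4 * E * (D * D)"
    by (simp add: algebra_simps)
  moreover have "D * s = r + 2 * L * r'"
    using pderiv_cheb_half[OF e, of k]
    by (simp add: D_def s_def r_def r'_def L_def of_int_poly)
  ultimately have "E * (4 * E * (D * D))
      = E * ((L + 4 * E) * ((r + 2 * L * r') * (r + 2 * L * r')) - D * D * (L * (r * r)))"
    by simp
  then have "4 * (D * D) = E * ((L + 4 * E) * ((r + 2 * L * r') * (r + 2 * L * r')) - D * D * (L * (r * r)))"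
    by (simp add: E mult.assoc mult.left_commute[of E 4])
  also have "\<dots> = (- E * (D * D - 1) * r - 4 * r') * (L * r)
      + 4 * (r + E * (L * (L + 4 * E)) * r') * (r + L * r')"
    by (simp add: algebra_simps E)
  also have "\<dots> = 4 * ((- E * M * r - r') * (L * r) + (r + E * (L * (L + 4 * E)) * r') * (r + L * r'))"
    unfolding M[symmetric] by (simp add: algebra_simps)
  finally have "(- E * M * r - r') * (L * r) + (r + E * (L * (L + 4 * E)) * r') * (r + L * r') = D * D"
    by simp
  moreover have "pderiv F = r + L * r'"
    by (simp only: F_def L_def r_def r'_def pderiv_linear_mult)
  moreover have "D * D = [:(2 * int k + 1)\<^sup>2:]" by (simp add: D_def of_int_poly power2_eq_square)
  ultimately show ?thesis
    by (intro that) (simp add: F_def L_def r_def)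
qed

section \<open>Congruences modulo l and its square\<close>

lemma monic_pderiv_mod_prime:
  fixes P :: "int poly"
  assumes "prime l" "degree P = l" "lead_coeff P = 1" "[:int l:] dvd pderiv P"
  shows "[:int l:] dvd P - (monom 1 l + [:coeff P 0:])"
  unfolding const_poly_dvd_iff
proof
  fix i
  have l: "l > 0" "prime (int l)" using assms(1) prime_gt_0_nat by auto
  show "int l dvd coeff (P - (monom 1 l + [:coeff P 0:])) i"
  \<comment> \<open>Coefficient i - 1 of P' is i times coefficient i of P, and i is invertible
    modulo l strictly between 0 and l.\<close>
  proof (cases "0 < i \<and> i < l")
    case True
    then obtain j where j: "i = Suc j" by (cases i) auto
    have "int l dvd coeff (pderiv P) j" using assms(4) by (simp add: const_poly_dvd_iff)
    then have "int l dvd int i * coeff P i" by (simp add: coeff_pderiv j)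
    moreover have "\<not> int l dvd int i" using True by (auto dest: dvd_imp_le)
    ultimately have "int l dvd coeff P i" using l(2) by (simp add: prime_dvd_mult_iff)
    then show ?thesis using True j by (simp add: coeff_pCons)
  next
    case False
    then consider "i = 0" | "i = l" | "i > l" by linarith
    then have "coeff (P - (monom 1 l + [:coeff P 0:])) i = 0"
      using assms(2,3) l(1) by cases (auto simp: coeff_pCons coeff_eq_0 split: nat.splits)
    then show ?thesis by simp
  qed
qed

lemma const_dvd_smult: "[:c:] dvd smult c p" for p :: "int poly"
  by (simp add: const_poly_dvd_iff)

lemma linear_power_mod_prime:
  assumes "prime l"
  shows "[:int l:] dvd [:t, 1:] ^ l - (monom 1 l + [:t ^ l:])"
proof -
  have "l > 0" using assms prime_gt_0_nat by blast
  then have "[:int l:] dvd pderiv ([:t, 1:] ^ l)"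
    by (simp add: pderiv_power pderiv_pCons const_dvd_smult)
  moreover have "degree ([:t, 1:] ^ l) = l" by (simp add: degree_power_eq)
  moreover have "lead_coeff ([:t, 1:] ^ l) = 1" by (simp only: lead_coeff_power) simp
  moreover have "coeff ([:t, 1:] ^ l) 0 = t ^ l" by (simp flip: poly_0_coeff_0)
  ultimately show ?thesis using monic_pderiv_mod_prime[OF assms, of "[:t, 1:] ^ l"] by simp
qed

text \<open>Fermat's little theorem, by induction on t in both directions from (a + 1)^l = a^l + 1
  modulo l.\<close>

lemma power_prime_cong_self_int:
  assumes "prime l"
  shows "int l dvd t ^ l - t"
proof -
  have l: "l > 0" using assms prime_gt_0_nat by blast
  have step: "int l dvd (a + 1) ^ l - a ^ l - 1" for a
  proof -
    obtain h where "[:1, 1:] ^ l - (monom 1 l + [:1 ^ l:]) = [:int l:] * h"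
      using linear_power_mod_prime[OF assms, of 1] by (auto simp: dvd_def)
    then have "poly ([:1, 1:] ^ l - (monom 1 l + [:1 ^ l:])) a = poly ([:int l:] * h) a" by simp
    then have "(a + 1) ^ l - a ^ l - 1 = int l * poly h a" by (simp add: poly_monom add.commute)
    then show ?thesis by simp
  qed
  show ?thesis
  proof (induction t rule: int_induct[of _ 0])
    case base
    then show ?case using l by (simp add: zero_power)
  next
    case (step1 a)
    have "(a + 1) ^ l - (a + 1) = ((a + 1) ^ l - a ^ l - 1) + (a ^ l - a)" by simp
    then show ?case using step step1 by (metis dvd_add)
  next
    case (step2 a)
    have "(a - 1) ^ l - (a - 1) = (a ^ l - a) - (((a - 1) + 1) ^ l - (a - 1) ^ l - 1)" by simp
    then show ?case using step step2 by (metis dvd_diff)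
  qed
qed

lemma chebyshev_T_prime_cong:
  assumes "prime l" "odd l"
  shows "[:int l:] dvd chebyshev_T l - monom 1 l"
proof -
  have l: "l > 0" using assms(1) prime_gt_0_nat by blast
  obtain k where k: "l = 2 * k + 1" using assms(2) by (auto elim: oddE)
  have "[:int l:] dvd pderiv (chebyshev_T l)"
    using pderiv_chebyshev_T[of 1 k] const_dvd_smult[of "int l"] by (simp add: k add.commute)
  moreover have "coeff (chebyshev_T l) 0 = 0"
  proof -
    \<comment> \<open>The choice z = \<i> gives z + 1/z = 0, so the constant term is \<i>^l +
      (-\<i>)^l, which vanishes for odd l.\<close>
    have "complex_of_int (coeff (chebyshev_T l) 0) = ipoly (chebyshev_T l) (\<i> + inverse \<i>)"
      by (simp add: poly_0_coeff_0)
    also have "\<dots> = \<i> ^ l + (- \<i>) ^ l" using chebyshev_T_monic(2)[OF l, of \<i>] by simp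
    also have "\<dots> = 0" using assms(2) by simp
    finally show ?thesis by simp
  qed
  ultimately show ?thesis
    using monic_pderiv_mod_prime[OF assms(1) degree_chebyshev_T[OF l] chebyshev_T_monic(1)[OF l]] by simp
qed

lemma pcompose_const_dvd:
  fixes P :: "int poly"
  assumes "[:c:] dvd P"
  shows "[:c:] dvd pcompose P Q"
  using assms by (elim dvdE) (simp add: pcompose_smult const_dvd_smult)

text \<open>Write U for T of index l^n and Y for (X - t)^(l^n). Modulo l, T_l(U) = U^l = (Y + t)^l =
  Y^l + t^l = Y^l + t; the four congruences in the induction step are these four equalities.\<close>

lemma chebyshev_T_prime_power_cong:
  assumes "prime l" "odd l"
  shows "[:int l:] dvd chebyshev_T (l ^ n) - [:t:] - [:- t, 1:] ^ (l ^ n)"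
proof (induction n)
  case 0
  have "chebyshev_T 1 = [:0, 1:]" by (rule chebyshev_T_eqI) auto
  then show ?case by simp
next
  case (Suc n)
  have l: "l > 0" using assms(1) prime_gt_0_nat by blast
  define U where "U = chebyshev_T (l ^ n)"
  define Y where "Y = [:- t, 1:] ^ (l ^ n)"
  have comp: "chebyshev_T (l ^ Suc n) = pcompose (chebyshev_T l) U"
    using l by (simp add: U_def chebyshev_T_pcompose)
  have "[:int l:] dvd pcompose (chebyshev_T l - monom 1 l) U"
    by (rule pcompose_const_dvd[OF chebyshev_T_prime_cong[OF assms]])
  then have 1: "[:int l:] dvd chebyshev_T (l ^ Suc n) - U ^ l"
    unfolding comp by (simp add: pcompose_diff monom_altdef pcompose_hom.hom_power pcompose_pCons)
  have "U - (Y + [:t:]) dvd U ^ l - (Y + [:t:]) ^ l" by (simp add: power_diff_sumr2)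
  moreover have "[:int l:] dvd U - (Y + [:t:])"
    using Suc by (simp add: U_def Y_def algebra_simps)
  ultimately have 2: "[:int l:] dvd U ^ l - (Y + [:t:]) ^ l" by (rule dvd_trans[rotated])
  have "[:int l:] dvd pcompose ([:t, 1:] ^ l - (monom 1 l + [:t ^ l:])) Y"
    by (rule pcompose_const_dvd[OF linear_power_mod_prime[OF assms(1)]])
  then have 3: "[:int l:] dvd (Y + [:t:]) ^ l - (Y ^ l + [:t ^ l:])"
    by (simp add: pcompose_diff pcompose_add monom_altdef pcompose_hom.hom_power pcompose_pCons add.commute)
  have 4: "[:int l:] dvd [:t ^ l - t:]" using power_prime_cong_self_int[OF assms(1)] by simp
  have "chebyshev_T (l ^ Suc n) - [:t:] - [:- t, 1:] ^ (l ^ Suc n)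
    = (chebyshev_T (l ^ Suc n) - U ^ l) + (U ^ l - (Y + [:t:]) ^ l)
      + ((Y + [:t:]) ^ l - (Y ^ l + [:t ^ l:])) + [:t ^ l - t:]"
    by (simp add: Y_def power_mult[symmetric] mult.commute)
  then show ?case using 1 2 3 4 by (simp only: dvd_add)
qed

text \<open>Two successive exact divisions by X - a give the second-order remainder without dividing
  by factorials.\<close>

lemma poly_taylor_1:
  fixes p :: "'a::idom poly"
  obtains q where "poly p (a + y) = poly p a + y * poly (pderiv p) a + y\<^sup>2 * poly q (a + y)"
proof -
  have lin: "\<exists>q. f = [:poly f a:] + [:- a, 1:] * q" for f
  proof -
    have "[:- a, 1:] dvd f - [:poly f a:]" by (simp flip: poly_eq_0_iff_dvd)
    then show ?thesis by (auto simp: dvd_def algebra_simps)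
  qed
  obtain p1 where p1: "p = [:poly p a:] + [:- a, 1:] * p1" using lin by blast
  obtain q where q: "p1 = [:poly p1 a:] + [:- a, 1:] * q" using lin by blast
  have "poly (pderiv p) a = poly p1 a"
    by (subst p1) (simp only: pderiv_add pderiv_linear_mult, simp)
  moreover have "poly p (a + y) = poly p a + y * poly p1 (a + y)" by (subst p1) (simp add: algebra_simps)
  moreover have "poly p1 (a + y) = poly p1 a + y * poly q (a + y)" by (subst q) (simp add: algebra_simps)
  ultimately show ?thesis
    by (intro that[of q]) (simp add: algebra_simps power2_eq_square)
qed

text \<open>T of index l^n at t equals T_l(a) with a congruent to t modulo l. In the Taylor
  expansion at t the linear term has a second factor l, because T_l' is divisible by l, and the
  remainder carries (a - t)^2.\<close>

lemma chebyshev_T_prime_power_cong_sq: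
  assumes "prime l" "odd l" "n > 0"
  shows "(int l)\<^sup>2 dvd poly (chebyshev_T (l ^ n)) t - poly (chebyshev_T l) t"
proof -
  have l: "l > 0" using assms(1) prime_gt_0_nat by blast
  obtain j where j: "n = Suc j" using assms(3) by (cases n) auto
  obtain k where k: "l = 2 * k + 1" using assms(2) by (auto elim: oddE)
  define a where "a = poly (chebyshev_T (l ^ j)) t"
  obtain h where "chebyshev_T (l ^ j) - [:t:] - [:- t, 1:] ^ (l ^ j) = [:int l:] * h"
    using chebyshev_T_prime_power_cong[OF assms(1,2)] by (metis dvdE)
  then have "poly (chebyshev_T (l ^ j) - [:t:] - [:- t, 1:] ^ (l ^ j)) t = poly ([:int l:] * h) t"
    by simp
  then have a: "a = t + int l * poly h t" using l by (simp add: a_def zero_power)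
  obtain q where q: "poly (chebyshev_T l) a = poly (chebyshev_T l) t
      + (int l * poly h t) * poly (pderiv (chebyshev_T l)) t + (int l * poly h t)\<^sup>2 * poly q a"
    using poly_taylor_1[of "chebyshev_T l" t "int l * poly h t"] unfolding a by metis
  have "poly (pderiv (chebyshev_T l)) t = int l * poly (cheb_half 1 k * cheb_half (- 1) k) t"
    using pderiv_chebyshev_T[of 1 k] by (simp add: k)
  moreover have "poly (chebyshev_T (l ^ n)) t = poly (chebyshev_T l) a"
    using l chebyshev_T_pcompose[of l "l ^ j"] by (simp add: j a_def flip: poly_pcompose)
  ultimately show ?thesis using q by (simp add: power2_eq_square)
qed

section \<open>The number field of a monic irreducible polynomial\<close>

lemma of_rat_poly_mult:
  "map_poly (of_rat :: rat \<Rightarrow> complex) (p * q) = map_poly of_rat p * map_poly of_rat q"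
proof -
  interpret map_poly_comm_ring_hom "of_rat :: rat \<Rightarrow> complex" ..
  show ?thesis by (rule hom_mult)
qed

lemma of_rat_poly_diff:
  "map_poly (of_rat :: rat \<Rightarrow> complex) (p - q) = map_poly of_rat p - map_poly of_rat q"
  by (rule poly_eqI) (simp add: coeff_map_poly of_rat_diff)

abbreviation rpoly :: "rat poly \<Rightarrow> complex \<Rightarrow> complex" where
  "rpoly q x \<equiv> poly (map_poly of_rat q) x"

lemmas rpoly_simps = of_rat_poly_mult of_rat_hom.map_poly_hom_add
  of_rat_hom.map_poly_hom_smult of_rat_hom.map_poly_pCons_hom of_rat_hom.map_poly_hom_monom

lemma of_rat_of_int_poly: "map_poly of_rat (of_int_poly g) = (of_int_poly g :: complex poly)"
  by (rule poly_eqI) (simp add: coeff_map_poly)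

lemma rpoly_of_int_poly: "rpoly (of_int_poly g) x = ipoly g x"
  unfolding of_rat_of_int_poly ..

lemma rat_poly_common_denominator:
  fixes q :: "rat poly"
  obtains m g where "m > 0" "smult (of_int m) q = of_int_poly g"
proof -
  have "\<exists>m g. m > 0 \<and> smult (of_int m) q = of_int_poly g"
  proof (induction q)
    case 0
    show ?case by (intro exI[of _ 1] exI[of _ 0]) auto
  next
    case (pCons a q)
    then obtain m g where m: "m > 0" "smult (of_int m) q = of_int_poly g" by blast
    obtain x y where xy: "a = of_int x / of_int y" "y > 0" by (cases a) (auto simp: Fract_of_int_quotient)
    have "smult (of_int (y * m)) (pCons a q) = pCons (of_int (m * x)) (smult (of_int y) (smult (of_int m) q))"
      using xy by simp
    also have "\<dots> = of_int_poly (pCons (m * x) (smult y g))"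
      by (simp add: m(2) of_int_hom.map_poly_pCons_hom of_int_hom.map_poly_hom_smult)
    finally show ?case using m(1) xy(2) by (intro exI[of _ "y * m"]) auto
  qed
  then show ?thesis using that by blast
qed

lemma complex_subfieldD:
  assumes "complex_subfield K"
  shows "0 \<in> K" "1 \<in> K" "x \<in> K \<Longrightarrow> y \<in> K \<Longrightarrow> x + y \<in> K" "x \<in> K \<Longrightarrow> y \<in> K \<Longrightarrow> x * y \<in> K"
    "x \<in> K \<Longrightarrow> - x \<in> K" "x \<in> K \<Longrightarrow> inverse x \<in> K"
  using assms by (auto simp: complex_subfield_def)

lemma of_rat_in_complex_subfield:
  assumes "complex_subfield K"
  shows "of_rat r \<in> K"
proof -
  note K = complex_subfieldD[OF assms]
  have nat: "of_nat k \<in> K" for k by (induction k) (use K in auto)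
  have int: "of_int k \<in> K" for k
    by (cases k rule: int_cases2) (use nat K in auto)
  obtain x y where "r = of_int x / of_int y" by (cases r) (auto simp: Fract_of_int_quotient)
  then have "of_rat r = of_int x * inverse (of_int y :: complex)"
    by (simp add: of_rat_divide field_simps)
  then show ?thesis using int K(4,6) by simp
qed

lemma rpoly_in_complex_subfield:
  assumes "complex_subfield K" "x \<in> K"
  shows "rpoly q x \<in> K"
proof (induction q)
  case 0
  show ?case using complex_subfieldD(1)[OF assms(1)] by simp
next
  case (pCons a q)
  have "of_rat a + x * rpoly q x \<in> K"
    by (rule complex_subfieldD(3)[OF assms(1) of_rat_in_complex_subfield[OF assms(1)]
          complex_subfieldD(4)[OF assms pCons.IH]])
  then show ?case by (simp add: of_rat_hom.map_poly_pCons_hom)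
qed

text \<open>A nonzero element of least degree in the ideal (P, q) divides both generators;
  irreducibility of P and the failure of P to divide q make it a unit.\<close>

lemma irreducible_bezout:
  fixes P q :: "'a::field poly"
  assumes "irreducible P" "\<not> P dvd q"
  obtains u v where "u * P + v * q = 1"
proof -
  define I where "I = {u * P + v * q | u v. True}"
  have mult: "f * a \<in> I" if a: "a \<in> I" for f a
  proof -
    obtain u v where "a = u * P + v * q" using a by (auto simp: I_def)
    then have "f * a = (f * u) * P + (f * v) * q" by (simp add: algebra_simps)
    then show ?thesis unfolding I_def by blast
  qed
  have diff: "a - b \<in> I" if ab: "a \<in> I" "b \<in> I" for a b
  proof -
    obtain u v u' v' where "a = u * P + v * q" "b = u' * P + v' * q" using ab by (auto simp: I_def)
    then have "a - b = (u - u') * P + (v - v') * q" by (simp add: algebra_simps)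
    then show ?thesis unfolding I_def by blast
  qed
  have Pq: "P \<in> I" "q \<in> I"
    unfolding I_def by (rule CollectI, rule exI[of _ 1], rule exI[of _ 0], simp)
      (rule CollectI, rule exI[of _ 0], rule exI[of _ 1], simp)
  moreover have "P \<noteq> 0" using assms(1) by auto
  ultimately have "P \<in> I \<and> P \<noteq> 0" by simp
  then obtain g where "(g \<in> I \<and> g \<noteq> 0) \<and> (\<forall>h. h \<in> I \<and> h \<noteq> 0 \<longrightarrow> degree g \<le> degree h)"
    using ex_has_least_nat[of "\<lambda>g. g \<in> I \<and> g \<noteq> 0" P degree] by blast
  then have g: "g \<in> I" "g \<noteq> 0" "\<And>h. h \<in> I \<Longrightarrow> h \<noteq> 0 \<Longrightarrow> degree g \<le> degree h" by auto
  have dvd: "g dvd f" if "f \<in> I" for f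
  proof (rule ccontr)
    assume "\<not> g dvd f"
    then have nz: "f mod g \<noteq> 0" by (simp add: dvd_eq_mod_eq_0)
    have "f mod g \<in> I"
      using diff[OF that mult[OF g(1), of "f div g"]] by (simp add: minus_div_mult_eq_mod)
    then have "degree g \<le> degree (f mod g)" using g(3) nz by blast
    then show False using degree_mod_less[OF g(2), of f] nz by simp
  qed
  obtain h where h: "P = g * h" using dvd[OF Pq(1)] by (rule dvdE)
  have "is_unit g"
  proof (rule ccontr)
    assume "\<not> is_unit g"
    then have "is_unit h" using assms(1) h by (auto dest: irreducibleD)
    then have "P dvd g" unfolding h by (simp add: mult_unit_dvd_iff)
    then show False using dvd[OF Pq(2)] assms(2) dvd_trans by blast
  qed
  then obtain g' where "1 = g * g'" by (rule dvdE)
  then have "1 \<in> I" using mult[OF g(1), of g'] by (simp add: mult.commute)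
  then obtain u v where "1 = u * P + v * q" by (auto simp: I_def)
  then show ?thesis by (intro that[of u v]) simp
qed

section \<open>The field generated by a root, its conjugates and its integers\<close>

locale monic_irreducible =
  fixes \<Phi> :: "int poly" and \<theta> :: complex
  assumes monic: "lead_coeff \<Phi> = 1"
    and irred: "irreducible (of_int_poly \<Phi> :: rat poly)"
    and root: "ipoly \<Phi> \<theta> = 0"
begin

abbreviation "N \<equiv> degree \<Phi>"

definition roots :: "complex set" where
  "roots = {a. ipoly \<Phi> a = 0}"

lemma theta_in_roots: "\<theta> \<in> roots"
  using root by (simp add: roots_def)

lemma degree_pos: "N > 0"
proof (rule Nat.gr0I)
  assume "N = 0"
  then obtain c where "\<Phi> = [:c:]" by (rule degree_eq_zeroE)
  then show False using root monic by simp
qed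

text \<open>A polynomial prime to \<Phi> cannot vanish at a root of \<Phi>, by Bezout. Because the
  right side does not mention a, every rational relation satisfied by one root holds at all of
  them.\<close>

lemma rpoly_eq_0_iff:
  assumes "a \<in> roots"
  shows "rpoly q a = 0 \<longleftrightarrow> of_int_poly \<Phi> dvd q"
proof
  assume q: "rpoly q a = 0"
  show "of_int_poly \<Phi> dvd q"
  proof (rule ccontr)
    assume "\<not> of_int_poly \<Phi> dvd q"
    then obtain u v where "u * of_int_poly \<Phi> + v * q = 1" by (rule irreducible_bezout[OF irred])
    then have "rpoly (u * of_int_poly \<Phi> + v * q) a = rpoly 1 a" by simp
    then show False using q assms by (simp add: rpoly_simps rpoly_of_int_poly roots_def)
  qed
next
  assume "of_int_poly \<Phi> dvd q"
  then show "rpoly q a = 0"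
    using assms by (auto simp: rpoly_simps rpoly_of_int_poly roots_def elim!: dvdE)
qed

lemma rpoly_eq_0_degree:
  assumes "rpoly q \<theta> = 0" "degree q < N"
  shows "q = 0"
proof -
  obtain p where p: "q = of_int_poly \<Phi> * p" using assms(1) rpoly_eq_0_iff[OF theta_in_roots] by (auto elim: dvdE)
  then show ?thesis using monic_multiple_eq_0[OF p] assms(2) by simp
qed

lemma ipoly_eq_0_degree:
  assumes "ipoly g \<theta> = 0" "degree g < N"
  shows "g = 0"
  using rpoly_eq_0_degree[of "of_int_poly g"] assms by (simp add: rpoly_of_int_poly)

lemma ipoly_eq_0_obtain:
  assumes "ipoly g \<theta> = 0"
  obtains Q where "g = \<Phi> * Q"
proof -
  obtain Q H where QH: "g = \<Phi> * Q + H" "H = 0 \<or> degree H < N"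
    using monic_int_division[OF monic] by blast
  then have "ipoly H \<theta> = 0" using assms root by (simp add: of_int_poly_simps)
  then have "H = 0" using QH(2) ipoly_eq_0_degree by blast
  with QH show ?thesis by (intro that[of Q]) simp
qed

text \<open>A multiple root would force \<Phi> to divide its derivative, which is nonzero and of
  smaller degree.\<close>

lemma Phi_rsquarefree: "rsquarefree (of_int_poly \<Phi> :: complex poly)"
  unfolding rsquarefree_roots
proof (intro allI notI)
  fix a assume a: "ipoly \<Phi> a = 0 \<and> poly (pderiv (of_int_poly \<Phi>)) a = 0"
  then have "rpoly (of_int_poly (pderiv \<Phi>)) a = 0"
    unfolding rpoly_of_int_poly by (simp add: of_int_hom.map_poly_pderiv)
  moreover have "a \<in> roots" using a by (simp add: roots_def)
  ultimately have "(of_int_poly \<Phi> :: rat poly) dvd of_int_poly (pderiv \<Phi>)"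
    using rpoly_eq_0_iff[of a "of_int_poly (pderiv \<Phi>)"] by simp
  then obtain p where p: "(of_int_poly (pderiv \<Phi>) :: rat poly) = of_int_poly \<Phi> * p" by (rule dvdE)
  have "degree (of_int_poly (pderiv \<Phi>) :: rat poly) < degree (of_int_poly \<Phi> :: rat poly)"
    using degree_pos by (simp add: degree_pderiv)
  then have "(of_int_poly (pderiv \<Phi>) :: rat poly) = 0"
    by (intro monic_multiple_eq_0[OF p]) simp
  then have "pderiv \<Phi> = 0" by simp
  then show False using degree_pos by (simp add: pderiv_eq_0_iff)
qed

lemma of_int_Phi_nonzero: "(of_int_poly \<Phi> :: complex poly) \<noteq> 0"
  using Phi_rsquarefree by (auto simp: rsquarefree_def)

lemma card_roots: "card roots = N"
  using rsquarefree_card_degree[OF of_int_Phi_nonzero] Phi_rsquarefree by (simp add: roots_def)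

lemma rat_adjoin_eq: "rat_adjoin \<theta> = range (\<lambda>q. rpoly q \<theta>)"
proof
  have "complex_subfield (range (\<lambda>q. rpoly q \<theta>))"
    unfolding complex_subfield_def
  proof (intro conjI ballI)
    show "0 \<in> range (\<lambda>q. rpoly q \<theta>)" by (intro range_eqI[of _ _ 0]) simp
    show "1 \<in> range (\<lambda>q. rpoly q \<theta>)" by (intro range_eqI[of _ _ 1]) simp
  next
    fix x y assume "x \<in> range (\<lambda>q. rpoly q \<theta>)" "y \<in> range (\<lambda>q. rpoly q \<theta>)"
    then obtain p q where pq: "x = rpoly p \<theta>" "y = rpoly q \<theta>" by blast
    show "x + y \<in> range (\<lambda>q. rpoly q \<theta>)"
      using pq by (intro range_eqI[of _ _ "p + q"]) (simp add: rpoly_simps)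
    show "x * y \<in> range (\<lambda>q. rpoly q \<theta>)"
      using pq by (intro range_eqI[of _ _ "p * q"]) (simp add: rpoly_simps)
  next
    fix x assume "x \<in> range (\<lambda>q. rpoly q \<theta>)"
    then obtain p where p: "x = rpoly p \<theta>" by blast
    show "- x \<in> range (\<lambda>q. rpoly q \<theta>)"
    proof (rule range_eqI)
      show "- x = rpoly (smult (- 1) p) \<theta>"
        by (simp only: of_rat_hom.map_poly_hom_smult) (simp add: p)
    qed
    show "inverse x \<in> range (\<lambda>q. rpoly q \<theta>)"
    proof (cases "x = 0")
      case True
      then show ?thesis by (intro range_eqI[of _ _ 0]) simp
    next
      case False
      \<comment> \<open>The inverse is the coefficient of p in a Bezout relation with
        \<Phi>.\<close>
      then have "\<not> of_int_poly \<Phi> dvd p" using p rpoly_eq_0_iff[OF theta_in_roots] by simp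
      then obtain u v where "u * of_int_poly \<Phi> + v * p = 1" by (rule irreducible_bezout[OF irred])
      then have "rpoly (u * of_int_poly \<Phi> + v * p) \<theta> = rpoly 1 \<theta>" by simp
      then have "rpoly v \<theta> * x = 1"
        using root by (simp add: rpoly_simps rpoly_of_int_poly p)
      then have "inverse x = rpoly v \<theta>" using False by (simp add: field_simps)
      then show ?thesis by blast
    qed
  qed
  moreover have "\<theta> \<in> range (\<lambda>q. rpoly q \<theta>)"
    by (intro range_eqI[of _ _ "[:0, 1:]"]) (simp add: rpoly_simps)
  ultimately show "rat_adjoin \<theta> \<subseteq> range (\<lambda>q. rpoly q \<theta>)"
    unfolding rat_adjoin_def by blast
  show "range (\<lambda>q. rpoly q \<theta>) \<subseteq> rat_adjoin \<theta>"
    unfolding rat_adjoin_def using rpoly_in_complex_subfield by blast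
qed

abbreviation "K \<equiv> rat_adjoin \<theta>"

lemma rpoly_in_K: "rpoly q \<theta> \<in> K"
  by (simp add: rat_adjoin_eq)

lemma ipoly_divide_in_K: "ipoly g \<theta> / of_int m \<in> K"
proof -
  have "ipoly g \<theta> / of_int m = rpoly (smult (1 / of_int m) (of_int_poly g)) \<theta>"
    by (simp add: rpoly_simps rpoly_of_int_poly of_rat_divide)
  then show ?thesis using rpoly_in_K by simp
qed

lemma obtain_reduced_rpoly:
  assumes "x \<in> K"
  obtains q where "x = rpoly q \<theta>" "degree q < N"
proof -
  obtain p where p: "x = rpoly p \<theta>" using assms by (auto simp: rat_adjoin_eq)
  have nz: "of_int_poly \<Phi> \<noteq> (0 :: rat poly)" using irred by auto
  have "rpoly p \<theta> = rpoly (of_int_poly \<Phi> * (p div of_int_poly \<Phi>) + p mod of_int_poly \<Phi>) \<theta>" by simp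
  then have "x = rpoly (p mod of_int_poly \<Phi>) \<theta>"
    unfolding rpoly_simps p using root by (simp add: rpoly_of_int_poly del: mult_div_mod_eq)
  moreover have "degree (p mod of_int_poly \<Phi>) < N"
    using degree_mod_less'[of "of_int_poly \<Phi>" p] degree_pos nz by (cases "p mod of_int_poly \<Phi> = 0") auto
  ultimately show ?thesis by (rule that)
qed

lemma obtain_ipoly_divide:
  assumes "x \<in> K"
  obtains g m where "m > 0" "x = ipoly g \<theta> / of_int m" "degree g < N"
proof -
  obtain q where q: "x = rpoly q \<theta>" "degree q < N" using assms by (rule obtain_reduced_rpoly)
  obtain m g where mg: "m > 0" "smult (of_int m) q = of_int_poly g"
    by (rule rat_poly_common_denominator)
  have "ipoly g \<theta> = of_int m * x"
    using arg_cong[OF mg(2), of "\<lambda>p. rpoly p \<theta>"] by (simp add: rpoly_simps rpoly_of_int_poly q(1))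
  moreover have "degree g < N"
    using arg_cong[OF mg(2), of degree] q(2) mg(1) by simp
  ultimately show ?thesis using mg(1) by (intro that[of m g]) (auto simp: field_simps)
qed

text \<open>A monic integer equation f(q(\<theta>)) = 0 is a rational relation for \<theta>, hence
  also holds at a.\<close>

lemma algebraic_int_conjugate:
  assumes "algebraic_int (rpoly q \<theta>)" "a \<in> roots"
  shows "algebraic_int (rpoly q a)"
proof -
  obtain f where f: "ipoly f (rpoly q \<theta>) = 0" "lead_coeff f = 1"
    using assms(1) by (auto simp: algebraic_int_altdef_ipoly)
  have comp: "rpoly (pcompose (of_int_poly f) q) x = ipoly f (rpoly q x)" for x
    by (simp add: of_rat_hom.map_poly_pcompose poly_pcompose of_rat_of_int_poly)
  have "rpoly (pcompose (of_int_poly f) q) \<theta> = 0" by (simp add: comp f)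
  then have "rpoly (pcompose (of_int_poly f) q) a = 0"
    using rpoly_eq_0_iff theta_in_roots assms(2) by metis
  then show ?thesis using f(2) by (auto simp: comp algebraic_int_altdef_ipoly)
qed

lemma algebraic_int_conjugate_ipoly:
  assumes "algebraic_int (ipoly g \<theta> / of_int m)" "a \<in> roots"
  shows "algebraic_int (ipoly g a / of_int m)"
  using algebraic_int_conjugate[of "smult (1 / of_int m) (of_int_poly g)" a] assms
  by (simp add: rpoly_simps rpoly_of_int_poly of_rat_divide)

abbreviation "\<O> \<equiv> ring_of_integers K"

definition Ztheta :: "complex set" where
  "Ztheta = range (\<lambda>g. ipoly g \<theta>)"

lemma algebraic_int_theta: "algebraic_int \<theta>"
  using monic root by (rule algebraic_int_root_of_monic)

lemma ipoly_in_O: "ipoly g \<theta> \<in> \<O>"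
  using ipoly_divide_in_K[of g 1] algebraic_int_theta by (auto simp: ring_of_integers_def)

lemma Ztheta_subset: "Ztheta \<subseteq> \<O>"
  using ipoly_in_O by (auto simp: Ztheta_def)

lemma obtain_reduced_ipoly:
  assumes "x \<in> Ztheta"
  obtains g where "x = ipoly g \<theta>" "degree g < N"
proof -
  obtain f where f: "x = ipoly f \<theta>" using assms by (auto simp: Ztheta_def)
  obtain Q H where QH: "f = \<Phi> * Q + H" "H = 0 \<or> degree H < N"
    using monic_int_division[OF monic] by blast
  then show ?thesis using root degree_pos f by (intro that[of H]) (auto simp: of_int_poly_simps)
qed

text \<open>All conjugates of x = g(\<theta>) / m are integral, so \<open>euler_dual\<close>
  applies; evaluating its identity at \<theta> kills \<Phi> Q and leaves g(\<theta>)
  \<Phi>'(\<theta>) = m h(\<theta>).\<close>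

lemma O_times_deriv:
  assumes "x \<in> \<O>"
  shows "ipoly (pderiv \<Phi>) \<theta> * x \<in> Ztheta"
proof -
  have x: "x \<in> K" "algebraic_int x" using assms by (auto simp: ring_of_integers_def)
  obtain g m where gm: "m > 0" "x = ipoly g \<theta> / of_int m" using obtain_ipoly_divide[OF x(1)] by metis
  have "algebraic_int (ipoly g a / of_int m)" if "ipoly \<Phi> a = 0" for a
    using algebraic_int_conjugate_ipoly x(2) that by (simp add: gm(2) roots_def)
  then obtain h Q where hQ: "g * pderiv \<Phi> = \<Phi> * Q + smult m h"
    using euler_dual[OF monic Phi_rsquarefree, of m g] gm(1) by (metis less_irrefl)
  have "ipoly g \<theta> * ipoly (pderiv \<Phi>) \<theta> = of_int m * ipoly h \<theta>"
    using arg_cong[OF hQ, of "\<lambda>p. ipoly p \<theta>"] root by (simp add: of_int_poly_simps)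
  then have "of_int m * (ipoly (pderiv \<Phi>) \<theta> * x) = of_int m * ipoly h \<theta>"
    using gm by (simp add: mult.commute)
  then have "ipoly (pderiv \<Phi>) \<theta> * x = ipoly h \<theta>"
    using gm(1) by simp
  then show ?thesis by (auto simp: Ztheta_def)
qed

text \<open>The product over \<open>roots\<close> is the field norm; its explicit value gives the
  contradiction in \<open>wild_prime\<close>.\<close>

lemma algebraic_int_norm:
  assumes "algebraic_int (ipoly g \<theta> / of_int m)"
  shows "algebraic_int ((\<Prod>a\<in>roots. ipoly g a) / of_int m ^ N)"
proof -
  have "algebraic_int (\<Prod>a\<in>roots. ipoly g a / of_int m)"
    using algebraic_int_conjugate_ipoly[OF assms] by blast
  then show ?thesis by (simp add: prod_dividef card_roots)
qed

end

lemma complex_subfield_rat_adjoin: "complex_subfield (rat_adjoin x)"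
  unfolding complex_subfield_def rat_adjoin_def by auto

section \<open>Discriminants\<close>

lemma sum_lessThan_coeff_mult_power:
  assumes "degree p < n"
  shows "(\<Sum>i<n. coeff p i * x ^ i) = poly p (x :: 'a::comm_semiring_1)"
  unfolding poly_altdef using assms
  by (intro sum.mono_neutral_right) (auto simp: coeff_eq_0)

text \<open>Multiplication by the unitriangular coefficient matrix of the Newton polynomials
  \<open>\<Prod>\<^sub>i\<^sub><\<^sub>j (x - r\<^sub>i)\<close> makes the Vandermonde matrix triangular.\<close>

lemma det_vandermonde:
  fixes r :: "nat \<Rightarrow> 'a::idom"
  shows "det (mat n n (\<lambda>(j, k). r k ^ j)) = (\<Prod>j<n. \<Prod>i<j. r j - r i)"
proof -
  define p where "p j = (\<Prod>i<j. [:- r i, 1:])" for j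
  have deg: "degree (p j) = j" for j
    unfolding p_def by (subst degree_prod_eq_sum_degree) auto
  have lead: "coeff (p j) j = 1" for j
    using lead_coeff_prod[of "\<lambda>i. [:- r i, 1:]" "{..<j}"] deg[of j] by (simp add: p_def)
  define L where "L = mat n n (\<lambda>(j, i). coeff (p j) i)"
  define V where "V = mat n n (\<lambda>(j, k). r k ^ j)"
  define P where "P = mat n n (\<lambda>(j, k). poly (p j) (r k))"
  have carrier: "L \<in> carrier_mat n n" "V \<in> carrier_mat n n" "P \<in> carrier_mat n n"
    by (auto simp: L_def V_def P_def)
  have "L * V = P"
  proof (rule eq_matI)
    fix j k assume jk: "j < dim_row P" "k < dim_col P"
    then have "(L * V) $$ (j, k) = (\<Sum>i<n. coeff (p j) i * r k ^ i)"
      by (simp add: L_def V_def P_def scalar_prod_def atLeast0LessThan)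
    also have "\<dots> = poly (p j) (r k)"
      using jk deg by (intro sum_lessThan_coeff_mult_power) (simp add: P_def)
    finally show "(L * V) $$ (j, k) = P $$ (j, k)" using jk by (simp add: P_def)
  qed (auto simp: L_def V_def P_def)
  moreover have "det L = 1"
  proof -
    have "det L = prod_list (diag_mat L)"
      by (rule det_lower_triangular[OF _ carrier(1)]) (auto simp: L_def coeff_eq_0 deg)
    also have "\<dots> = 1" unfolding prod_list_diag_prod by (simp add: L_def lead)
    finally show ?thesis .
  qed
  moreover have "det P = (\<Prod>j<n. \<Prod>i<j. r j - r i)"
  proof -
    have "poly (p j) (r k) = 0" if "k < j" for j k
      using that by (auto simp: p_def poly_prod)
    then have "upper_triangular P" by (auto simp: P_def upper_triangular_def)
    then have "det P = prod_list (diag_mat P)" using carrier(3) by (rule det_upper_triangular)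
    also have "\<dots> = (\<Prod>j<n. \<Prod>i<j. r j - r i)"
      unfolding prod_list_diag_prod by (simp add: P_def p_def poly_prod atLeast0LessThan)
    finally show ?thesis .
  qed
  ultimately show ?thesis using det_mult[OF carrier(1,2)] by (simp add: V_def)
qed

section \<open>Embeddings, traces and change of basis\<close>

context monic_irreducible
begin

text \<open>An embedding fixes 1, hence the natural numbers, the integers and the rationals, so it
  is determined by the image of \<theta>.\<close>

lemma field_embedding_rpoly:
  assumes "\<sigma> \<in> field_embeddings K"
  shows "\<sigma> (rpoly q \<theta>) = rpoly q (\<sigma> \<theta>)"
proof -
  note K = complex_subfieldD[OF complex_subfield_rat_adjoin, of \<theta>]
  note Kr = of_rat_in_complex_subfield[OF complex_subfield_rat_adjoin, of _ \<theta>]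
  have \<sigma>: "\<sigma> 1 = 1" "x \<in> K \<Longrightarrow> y \<in> K \<Longrightarrow> \<sigma> (x + y) = \<sigma> x + \<sigma> y"
    "x \<in> K \<Longrightarrow> y \<in> K \<Longrightarrow> \<sigma> (x * y) = \<sigma> x * \<sigma> y" for x y
    using assms by (auto simp: field_embeddings_def)
  have zero: "\<sigma> 0 = 0" using \<sigma>(2)[OF K(1) K(1)] by simp
  have Ki: "of_int k \<in> K" for k using Kr[of "of_int k"] by simp
  have Kn: "of_nat k \<in> K" for k using Ki[of "int k"] by simp
  have nat: "\<sigma> (of_nat k) = of_nat k" for k
    by (induction k) (simp_all add: zero \<sigma>(1) \<sigma>(2)[OF K(2) Kn])
  have int: "\<sigma> (of_int k) = of_int k" for k
  proof (cases k rule: int_cases2)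
    case (nonneg n)
    then show ?thesis using nat by simp
  next
    case (nonpos n)
    have "\<sigma> (of_nat n + of_int k) = \<sigma> (of_nat n) + \<sigma> (of_int k)" by (rule \<sigma>(2)[OF Kn Ki])
    moreover have *: "of_nat n + of_int k = (0 :: complex)" using nonpos by simp
    ultimately have "of_nat n + \<sigma> (of_int k) = of_nat n + of_int k" using nat[of n] zero by simp
    then show ?thesis by (rule add_left_imp_eq)
  qed
  have rat: "\<sigma> (of_rat r) = of_rat r" for r
  proof -
    obtain x y where xy: "r = of_int x / of_int y" "y > 0" by (cases r) (auto simp: Fract_of_int_quotient)
    have "\<sigma> (of_rat r * of_int y) = \<sigma> (of_rat r) * \<sigma> (of_int y)" by (rule \<sigma>(3)[OF Kr Ki])
    moreover have "of_rat r * of_int y = (of_int x :: complex)"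
      using xy by (simp add: of_rat_divide)
    ultimately have "\<sigma> (of_rat r) * of_int y = of_rat r * of_int y" using int[of x] int[of y] by metis
    then show ?thesis using xy(2) by auto
  qed
  have "\<theta> \<in> K" using rpoly_in_K[of "[:0, 1:]"] by (simp add: rpoly_simps)
  then show ?thesis
  proof (induction q)
    case 0
    show ?case using zero by simp
  next
    case (pCons a q)
    have "\<sigma> (of_rat a + \<theta> * rpoly q \<theta>) = of_rat a + \<sigma> \<theta> * rpoly q (\<sigma> \<theta>)"
      using \<sigma>(2)[OF Kr K(4)[OF pCons.prems rpoly_in_K]] \<sigma>(3)[OF pCons.prems rpoly_in_K]
        rat pCons.IH[OF pCons.prems] by simp
    then show ?case by (simp add: rpoly_simps)
  qed
qed

text \<open>The embedding that sends \<theta> to a. For a root a the value does not depend on the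
  polynomial chosen by \<open>SOME\<close>; \<open>restrict\<close> meets the extensionality
  demanded by \<open>field_embeddings\<close>.\<close>

definition conjugation :: "complex \<Rightarrow> complex \<Rightarrow> complex" where
  "conjugation a = restrict (\<lambda>x. rpoly (SOME q. x = rpoly q \<theta>) a) K"

lemma conjugation_rpoly:
  assumes "a \<in> roots"
  shows "conjugation a (rpoly q \<theta>) = rpoly q a"
proof -
  define p where "p = (SOME p. rpoly q \<theta> = rpoly p \<theta>)"
  have "rpoly q \<theta> = rpoly p \<theta>" unfolding p_def by (rule someI[of _ q]) simp
  then have "rpoly (q - p) \<theta> = 0" by (simp add: of_rat_poly_diff)
  then have "rpoly (q - p) a = 0" using rpoly_eq_0_iff[OF theta_in_roots] rpoly_eq_0_iff[OF assms] by blast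
  then have "rpoly q a = rpoly p a" by (simp add: of_rat_poly_diff)
  then show ?thesis by (simp add: conjugation_def rpoly_in_K p_def)
qed

lemma conjugation_theta: "a \<in> roots \<Longrightarrow> conjugation a \<theta> = a"
  using conjugation_rpoly[of a "[:0, 1:]"] by (simp add: rpoly_simps)

lemma field_embeddings_eq: "field_embeddings K = conjugation ` roots"
proof
  show "field_embeddings K \<subseteq> conjugation ` roots"
  proof
    fix \<sigma> assume \<sigma>: "\<sigma> \<in> field_embeddings K"
    have "rpoly (of_int_poly \<Phi>) (\<sigma> \<theta>) = \<sigma> (rpoly (of_int_poly \<Phi>) \<theta>)"
      by (rule field_embedding_rpoly[OF \<sigma>, symmetric])
    also have "\<dots> = 0" using field_embedding_rpoly[OF \<sigma>, of 0] root by (simp add: rpoly_of_int_poly)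
    finally have root: "\<sigma> \<theta> \<in> roots" by (simp add: rpoly_of_int_poly roots_def)
    have "\<sigma> = conjugation (\<sigma> \<theta>)"
    proof (rule extensionalityI[of _ K])
      show "\<sigma> \<in> extensional K" using \<sigma> by (simp add: field_embeddings_def)
      show "conjugation (\<sigma> \<theta>) \<in> extensional K" by (simp add: conjugation_def)
    next
      fix x assume "x \<in> K"
      then obtain q where "x = rpoly q \<theta>" by (auto simp: rat_adjoin_eq)
      then show "\<sigma> x = conjugation (\<sigma> \<theta>) x"
        using field_embedding_rpoly[OF \<sigma>] conjugation_rpoly[OF root] by simp
    qed
    with root show "\<sigma> \<in> conjugation ` roots" by blast
  qed
  show "conjugation ` roots \<subseteq> field_embeddings K"
  proof
    fix \<sigma> assume "\<sigma> \<in> conjugation ` roots"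
    then obtain a where a: "a \<in> roots" "\<sigma> = conjugation a" by blast
    have "\<sigma> 1 = 1" using conjugation_rpoly[OF a(1), of 1] a(2) by simp
    moreover have "\<sigma> (x + y) = \<sigma> x + \<sigma> y \<and> \<sigma> (x * y) = \<sigma> x * \<sigma> y" if "x \<in> K" "y \<in> K" for x y
    proof -
      obtain p q where "x = rpoly p \<theta>" "y = rpoly q \<theta>" using \<open>x \<in> K\<close> \<open>y \<in> K\<close> by (auto simp: rat_adjoin_eq)
      then show ?thesis
        using conjugation_rpoly[OF a(1), of "p + q"] conjugation_rpoly[OF a(1), of "p * q"]
          conjugation_rpoly[OF a(1)] by (simp add: rpoly_simps a(2))
    qed
    ultimately show "\<sigma> \<in> field_embeddings K"
      by (simp add: field_embeddings_def a(2) conjugation_def)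
  qed
qed

lemma field_trace_rpoly: "field_trace K (rpoly q \<theta>) = (\<Sum>a\<in>roots. rpoly q a)"
proof -
  have "inj_on conjugation roots" by (rule inj_onI) (metis conjugation_theta)
  then have "field_trace K (rpoly q \<theta>) = (\<Sum>a\<in>roots. conjugation a (rpoly q \<theta>))"
    unfolding field_trace_def field_embeddings_eq by (simp add: sum.reindex)
  then show ?thesis by (simp add: conjugation_rpoly)
qed

lemma root_list:
  obtains r where "distinct r" "set r = roots" "length r = N"
    "monic_discriminant (of_int_poly \<Phi>) = (\<Prod>j<N. \<Prod>i<j. r ! j - r ! i)\<^sup>2"
proof -
  define r :: "complex list" where "r = (SOME r. mset r = proots (of_int_poly \<Phi>))"
  have r: "mset r = proots (of_int_poly \<Phi>)" unfolding r_def by (rule someI_ex) (rule ex_mset)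
  have set: "set r = roots"
    using set_count_proots[OF of_int_Phi_nonzero] unfolding set_mset_mset[symmetric] r
    by (simp add: roots_def)
  have len: "length r = N"
    using size_proots_complex[of "of_int_poly \<Phi>"] unfolding size_mset[symmetric] r by simp
  have "distinct r" using set len card_roots by (simp add: card_distinct)
  moreover have "monic_discriminant (of_int_poly \<Phi>) = (\<Prod>j<N. \<Prod>i<j. r ! j - r ! i)\<^sup>2"
    unfolding monic_discriminant_def Let_def r_def[symmetric] len by (simp add: prod_power_distrib)
  ultimately show ?thesis using set len that by blast
qed

end

context monic_irreducible
begin

lemma rpoly_eq_sum: "degree q < n \<Longrightarrow> rpoly q x = (\<Sum>j<n. of_rat (coeff q j) * x ^ j)"
  using sum_lessThan_coeff_mult_power[of "map_poly of_rat q" n x] by (simp add: coeff_map_poly)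

lemma integral_basis_obtain:
  assumes "integral_basis K b" "x \<in> \<O>"
  obtains c :: "nat \<Rightarrow> int" where "x = (\<Sum>i<length b. of_int (c i) * b ! i)"
  using assms unfolding integral_basis_def by metis

text \<open>Clearing denominators gives an integer relation, and the uniqueness clause for the
  representation of 0 makes it trivial.\<close>

lemma integral_basis_rat_independent:
  fixes r :: "nat \<Rightarrow> rat"
  assumes b: "integral_basis K b" and sum: "(\<Sum>k<length b. of_rat (r k) * b ! k) = 0" and k: "k < length b"
  shows "r k = 0"
proof -
  define m where "m = length b"
  \<comment> \<open>The coefficients are packed into a polynomial only to obtain a common
    denominator.\<close>
  define p where "p = (\<Sum>k<m. monom (r k) k)"
  have p: "coeff p k = r k" if "k < m" for k
    using that by (simp add: p_def coeff_sum)
  obtain d g where dg: "d > 0" "smult (of_int d) p = of_int_poly g"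
    by (rule rat_poly_common_denominator)
  have g: "of_int d * r k = of_int (coeff g k)" if "k < m" for k
    using arg_cong[OF dg(2), of "\<lambda>p. coeff p k"] p[OF that] by simp
  have g': "complex_of_int (coeff g k) = of_int d * of_rat (r k)" if "k < m" for k
    using arg_cong[OF g[OF that], of "of_rat :: rat \<Rightarrow> complex"] by (simp add: of_rat_mult)
  have "(\<Sum>k<m. of_int (coeff g k) * b ! k) = of_int d * (\<Sum>k<m. of_rat (r k) * b ! k)"
    unfolding sum_distrib_left by (intro sum.cong) (auto simp: g')
  then have zero: "(\<Sum>k<m. of_int (coeff g k) * b ! k) = 0" using sum by (simp add: m_def)
  have "0 \<in> \<O>" using ipoly_in_O[of 0] by simp
  then have "\<exists>!c :: int list. length c = m \<and> 0 = (\<Sum>i<m. of_int (c ! i) * b ! i)"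
    using b unfolding integral_basis_def m_def by blast
  moreover have "length (map (coeff g) [0..<m]) = m \<and> 0 = (\<Sum>i<m. of_int (map (coeff g) [0..<m] ! i) * b ! i)"
    using zero by simp
  moreover have "length (replicate m 0) = m \<and> 0 = (\<Sum>i<m. of_int (replicate m 0 ! i) * b ! i)" by simp
  ultimately have "map (coeff g) [0..<m] = replicate m 0" by blast
  then have "map (coeff g) [0..<m] ! k = replicate m 0 ! k" by simp
  then show ?thesis using g[of k] dg(1) k by (simp add: m_def)
qed

text \<open>Let C be the rational matrix of b in the powers of \<theta>, and B the integer matrix of
  the powers in b, inverse to C. The trace matrix of b is P P^T with P = C V and V the Vandermonde
  matrix of the roots, so its determinant is det(C)^2 times the discriminant of \<Phi>. Equality
  therefore means det(C)^2 = 1, that is, C is integral.\<close>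

theorem discriminant_eq_iff:
  assumes b: "integral_basis K b"
  shows "monic_discriminant (of_int_poly \<Phi>)
      = det (mat (length b) (length b) (\<lambda>(i, j). field_trace K (b ! i * b ! j)))
    \<longleftrightarrow> \<O> = Ztheta"
proof -
  have bO: "b ! i \<in> \<O>" if "i < length b" for i
    using b that unfolding integral_basis_def by (auto dest: nth_mem)
  have "\<exists>q. b ! i = rpoly q \<theta> \<and> degree q < N" if "i < length b" for i
    using bO[OF that] obtain_reduced_rpoly[of "b ! i"] by (auto simp: ring_of_integers_def)
  then obtain q where q: "\<And>i. i < length b \<Longrightarrow> b ! i = rpoly (q i) \<theta>"
      "\<And>i. i < length b \<Longrightarrow> degree (q i) < N" by metis
  have "\<exists>c :: nat \<Rightarrow> int. \<theta> ^ j = (\<Sum>i<length b. of_int (c i) * b ! i)" for j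
    using integral_basis_obtain[OF b ipoly_in_O[of "monom 1 j"]] by (auto simp: poly_monom)
  then obtain B :: "nat \<Rightarrow> nat \<Rightarrow> int"
    where B: "\<And>j. \<theta> ^ j = (\<Sum>i<length b. of_int (B j i) * b ! i)" by metis
  \<comment> \<open>B C = 1 holds because the powers of \<theta> below N are independent; C B = 1,
    proved next, uses the independence of b.\<close>
  have BC: "(\<Sum>i<length b. of_int (B j i) * coeff (q i) k) = (if j = k then 1 else 0)" if "j < N" for j k
  proof -
    define p where "p = (\<Sum>i<length b. smult (of_int (B j i)) (q i)) - monom 1 j"
    have "map_poly of_rat (\<Sum>i<length b. smult (of_int (B j i)) (q i))
        = (\<Sum>i<length b. smult (of_int (B j i)) (map_poly (of_rat :: rat \<Rightarrow> complex) (q i)))"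
      by (rule poly_eqI) (simp add: coeff_map_poly coeff_sum of_rat_sum of_rat_mult)
    then have "rpoly p \<theta> = 0"
      using B[of j] q(1) by (simp add: p_def of_rat_poly_diff poly_sum of_rat_hom.map_poly_hom_monom poly_monom)
    moreover have "degree p < N"
      unfolding p_def using q(2) degree_pos that
      by (intro degree_diff_less degree_sum_less)
        (auto intro: le_less_trans[OF degree_smult_le] simp: degree_monom_eq)
    ultimately have "p = 0" by (rule rpoly_eq_0_degree)
    then have "coeff p k = 0" by simp
    then show ?thesis by (simp add: p_def coeff_sum split: if_splits)
  qed
  have CB: "(\<Sum>j<N. coeff (q i) j * of_int (B j k)) = (if i = k then 1 else 0)"
    if "i < length b" "k < length b" for i k
  proof -
    define r where "r k = (\<Sum>j<N. coeff (q i) j * of_int (B j k)) - (if i = k then 1 else 0)" for k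
    have "(\<Sum>k<length b. of_rat (r k) * b ! k)
      = (\<Sum>k<length b. \<Sum>j<N. of_rat (coeff (q i) j) * (of_int (B j k) * b ! k))
        - (\<Sum>k<length b. if i = k then b ! k else 0)"
      unfolding sum_subtractf[symmetric]
      by (intro sum.cong)
        (auto simp: r_def of_rat_diff of_rat_sum of_rat_mult left_diff_distrib sum_distrib_right mult.assoc)
    also have "(\<Sum>k<length b. \<Sum>j<N. of_rat (coeff (q i) j) * (of_int (B j k) * b ! k))
      = (\<Sum>j<N. of_rat (coeff (q i) j) * \<theta> ^ j)"
      unfolding B sum_distrib_left by (rule sum.swap)
    also have "\<dots> = b ! i" using q[OF that(1)] rpoly_eq_sum by simp
    finally have "(\<Sum>k<length b. of_rat (r k) * b ! k) = 0" using that(1) by simp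
    then have "r k = 0" using that(2) by (rule integral_basis_rat_independent[OF b])
    then show ?thesis by (simp add: r_def)
  qed
  \<comment> \<open>The definition of an integral basis does not fix its length. The traces of B C
    and C B agree, and they equal N and the length of b.\<close>
  have len: "length b = N"
  proof -
    have "of_nat N = (\<Sum>j<N. \<Sum>i<length b. of_int (B j i) * coeff (q i) j)"
      using BC by simp
    also have "\<dots> = (\<Sum>i<length b. \<Sum>j<N. coeff (q i) j * of_int (B j i))"
      by (subst sum.swap) (simp add: mult.commute)
    also have "\<dots> = (of_nat (length b) :: rat)" using CB by simp
    finally show ?thesis by simp
  qed
  define MB where "MB = mat N N (\<lambda>(j, i). B j i)"
  define MC where "MC = mat N N (\<lambda>(i, j). coeff (q i) j)"
  have carrier: "MB \<in> carrier_mat N N" "MC \<in> carrier_mat N N" by (auto simp: MB_def MC_def)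
  have MBC: "map_mat of_int MB * MC = 1\<^sub>m N"
    by (rule eq_matI) (auto simp: MB_def MC_def scalar_prod_def atLeast0LessThan BC simp flip: len)
  have detBC: "of_int (det MB) * det MC = 1"
    using det_mult[of "map_mat of_int MB" N MC] carrier MBC by simp
  obtain r where r: "distinct r" "set r = roots" "length r = N"
    "monic_discriminant (of_int_poly \<Phi>) = (\<Prod>j<N. \<Prod>i<j. r ! j - r ! i)\<^sup>2" by (rule root_list)
  define V where "V = mat N N (\<lambda>(j, k). (r ! k) ^ j)"
  have V: "V \<in> carrier_mat N N" by (simp add: V_def)
  have disc: "monic_discriminant (of_int_poly \<Phi>) = (det V)\<^sup>2"
    unfolding V_def det_vandermonde[of N "\<lambda>k. r ! k"] r(4) ..
  have disc_nz: "(det V)\<^sup>2 \<noteq> 0"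
    unfolding V_def det_vandermonde[of N "\<lambda>k. r ! k"]
    using r(1,3) by (auto simp: prod_zero_iff nth_eq_iff_index_eq)
  define P where "P = map_mat of_rat MC * V"
  have P: "P \<in> carrier_mat N N" using carrier V by (simp add: P_def)
  have P_eq: "P $$ (i, k) = rpoly (q i) (r ! k)" if "i < N" "k < N" for i k
    using that q(2)[of i] rpoly_eq_sum[of "q i" N "r ! k"]
    by (simp add: P_def MC_def V_def scalar_prod_def atLeast0LessThan len)
  have "mat (length b) (length b) (\<lambda>(i, j). field_trace K (b ! i * b ! j)) = P * P\<^sup>T"
  proof (rule eq_matI)
    fix i j assume "i < dim_row (P * P\<^sup>T)" "j < dim_col (P * P\<^sup>T)"
    then have ij: "i < N" "j < N" using P by auto
    have "field_trace K (b ! i * b ! j) = field_trace K (rpoly (q i * q j) \<theta>)"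
      using ij q(1) len by (simp add: rpoly_simps)
    also have "\<dots> = (\<Sum>a\<in>roots. rpoly (q i * q j) a)" by (rule field_trace_rpoly)
    also have "\<dots> = (\<Sum>k<N. rpoly (q i * q j) (r ! k))"
      using sum.distinct_set_conv_list[OF r(1), of "rpoly (q i * q j)"]
      by (simp add: r(2) sum_list_sum_nth r(3) atLeast0LessThan)
    also have "\<dots> = (P * P\<^sup>T) $$ (i, j)"
      using ij P by (simp add: P_eq scalar_prod_def atLeast0LessThan rpoly_simps)
    finally show "mat (length b) (length b) (\<lambda>(i, j). field_trace K (b ! i * b ! j)) $$ (i, j)
      = (P * P\<^sup>T) $$ (i, j)" using ij len by simp
  qed (use P len in auto)
  then have "det (mat (length b) (length b) (\<lambda>(i, j). field_trace K (b ! i * b ! j))) = (det P)\<^sup>2"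
    using det_mult[OF P, of "P\<^sup>T"] P det_transpose[OF P] by (simp add: power2_eq_square)
  also have "det P = of_rat (det MC) * det V"
    unfolding P_def using carrier V by (subst det_mult[of _ N]) simp_all
  finally have "monic_discriminant (of_int_poly \<Phi>)
      = det (mat (length b) (length b) (\<lambda>(i, j). field_trace K (b ! i * b ! j)))
    \<longleftrightarrow> (of_rat ((det MC)\<^sup>2) :: complex) = of_rat 1"
    unfolding disc using disc_nz by (auto simp: power_mult_distrib of_rat_power)
  also have "\<dots> \<longleftrightarrow> (det MC)\<^sup>2 = 1" by (simp only: of_rat_eq_iff)
  also have "\<dots> \<longleftrightarrow> \<O> = Ztheta"
  proof
    assume "(det MC)\<^sup>2 = 1"
    then have "(of_int (det MB) * det MC)\<^sup>2 = (of_int (det MB))\<^sup>2" by (simp add: power_mult_distrib)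
    then have "(of_int ((det MB)\<^sup>2) :: rat) = of_int 1" unfolding detBC by simp
    then have "(det MB)\<^sup>2 = 1" by (simp only: of_int_eq_iff)
    then have detB: "det MB * det MB = 1" by (simp add: power2_eq_square)
    \<comment> \<open>The adjugate of B is det(B) C. With det(B)^2 = 1 this makes the entries of C
      integers, so each basis element lies in Z[\<theta>].\<close>
    have adj: "map_mat of_int (adj_mat MB) = of_int (det MB) \<cdot>\<^sub>m MC"
    proof -
      let ?A = "map_mat of_int (adj_mat MB) :: rat mat" and ?B = "map_mat of_int MB :: rat mat"
      have cA: "?A \<in> carrier_mat N N" "?B \<in> carrier_mat N N" using adj_mat(1)[OF carrier(1)] carrier by auto
      have "?A * ?B = map_mat of_int (det MB \<cdot>\<^sub>m 1\<^sub>m N)"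
        using adj_mat[OF carrier(1)] carrier(1) by (metis of_int_hom.mat_hom_mult)
      also have "\<dots> = of_int (det MB) \<cdot>\<^sub>m 1\<^sub>m N" by (rule eq_matI) auto
      finally have AB: "?A * ?B = of_int (det MB) \<cdot>\<^sub>m 1\<^sub>m N" .
      have "?A = ?A * (?B * MC)" using cA MBC by simp
      also have "\<dots> = (?A * ?B) * MC" using cA carrier by (simp add: assoc_mult_mat)
      also have "\<dots> = of_int (det MB) \<cdot>\<^sub>m MC"
        unfolding AB mult_smult_assoc_mat[OF one_carrier_mat carrier(2)] using carrier by simp
      finally show ?thesis .
    qed
    have int: "coeff (q i) j = of_int (det MB * adj_mat MB $$ (i, j))" if "i < N" "j < N" for i j
    proof -
      have "of_int (adj_mat MB $$ (i, j)) = of_int (det MB) * coeff (q i) j"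
        using arg_cong[OF adj, of "\<lambda>M. M $$ (i, j)"] that adj_mat(1)[OF carrier(1)]
        by (simp add: MC_def)
      then have "of_int (det MB * adj_mat MB $$ (i, j)) = of_int (det MB * det MB) * coeff (q i) j" by simp
      then show ?thesis unfolding detB by simp
    qed
    have bZ: "b ! i = ipoly (\<Sum>j<N. monom (det MB * adj_mat MB $$ (i, j)) j) \<theta>" if "i < N" for i
    proof -
      have "b ! i = (\<Sum>j<N. of_rat (coeff (q i) j) * \<theta> ^ j)"
        using q[of i] that len rpoly_eq_sum by simp
      also have "\<dots> = (\<Sum>j<N. of_int (det MB * adj_mat MB $$ (i, j)) * \<theta> ^ j)"
        by (intro sum.cong refl) (simp add: int that del: of_int_mult)
      also have "\<dots> = ipoly (\<Sum>j<N. monom (det MB * adj_mat MB $$ (i, j)) j) \<theta>"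
        by (simp add: of_int_poly_hom.hom_sum poly_sum of_int_hom.map_poly_hom_monom poly_monom)
      finally show ?thesis .
    qed
    show "\<O> = Ztheta"
    proof (rule equalityI[OF _ Ztheta_subset], rule subsetI)
      fix x assume "x \<in> \<O>"
      then obtain c where "x = (\<Sum>i<length b. of_int (c i) * b ! i)" using integral_basis_obtain[OF b] by metis
      also have "\<dots> = ipoly (\<Sum>i<N. smult (c i) (\<Sum>j<N. monom (det MB * adj_mat MB $$ (i, j)) j)) \<theta>"
        using bZ len
        by (simp add: of_int_poly_hom.hom_sum[of _ "{..<N}"] poly_sum of_int_hom.map_poly_hom_smult)
      finally show "x \<in> Ztheta" by (auto simp: Ztheta_def)
    qed
  next
    assume O: "\<O> = Ztheta"
    have "\<exists>g. b ! i = ipoly g \<theta> \<and> degree g < N" if "i < length b" for i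
      using bO[OF that] obtain_reduced_ipoly[of "b ! i"] unfolding O by metis
    then obtain g where g: "\<And>i. i < N \<Longrightarrow> b ! i = ipoly (g i) \<theta>" "\<And>i. i < N \<Longrightarrow> degree (g i) < N"
      unfolding len by metis
    have "q i = of_int_poly (g i)" if "i < N" for i
    proof -
      have "rpoly (q i - of_int_poly (g i)) \<theta> = 0"
        using q(1)[of i] g(1)[of i] that len by (simp add: of_rat_poly_diff rpoly_of_int_poly)
      moreover have "degree (q i - of_int_poly (g i)) < N"
        using q(2)[of i] g(2)[of i] that len by (intro degree_diff_less) auto
      ultimately have "q i - of_int_poly (g i) = 0" by (rule rpoly_eq_0_degree)
      then show ?thesis by simp
    qed
    then have "MC = map_mat of_int (mat N N (\<lambda>(i, j). coeff (g i) j))"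
      unfolding MC_def by (intro eq_matI) auto
    then have "det MC = of_int (det (mat N N (\<lambda>(i, j). coeff (g i) j)))" by simp
    then obtain c where c: "det MC = of_int c" by blast
    then have "(of_int (det MB * c) :: rat) = of_int 1" using detBC by simp
    then have "det MB * c = 1" by (simp only: of_int_eq_iff)
    then have "c = 1 \<or> c = - 1" using zmult_eq_1_iff by auto
    then show "(det MC)\<^sup>2 = 1" by (auto simp: c)
  qed
  finally show ?thesis .
qed

end

section \<open>Existence of an integral basis\<close>

text \<open>A Hermite normal form: f i minimises the absolute value of coefficient i among elements
  of H of degree at most i where it is nonzero. Division with remainder by this minimum removes the
  top coefficient of any such element, and the argument descends in degree.\<close>

lemma int_poly_subgroup_triangular_basis:
  fixes H :: "int poly set"
  assumes diff: "\<And>f g. f \<in> H \<Longrightarrow> g \<in> H \<Longrightarrow> f - g \<in> H"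
    and deg: "\<And>g. g \<in> H \<Longrightarrow> degree g < N"
    and full: "\<And>i. i < N \<Longrightarrow> \<exists>g\<in>H. degree g \<le> i \<and> coeff g i \<noteq> 0"
  shows "\<exists>f. (\<forall>i<N. f i \<in> H \<and> degree (f i) \<le> i \<and> coeff (f i) i \<noteq> 0) \<and>
    (\<forall>g\<in>H. \<exists>c. g = (\<Sum>i<N. smult (c i) (f i)))"
proof -
  have zero: "0 \<in> H" if "g \<in> H" for g using diff[OF that that] by simp
  have smult: "smult c g \<in> H" if "g \<in> H" for c g
  proof (induction c rule: int_induct[of _ 0])
    case base
    then show ?case using zero[OF that] by simp
  next
    case (step1 i)
    have "smult (i + 1) g = smult i g - (0 - g)" by (simp add: smult_add_left)
    then show ?case using diff[OF step1(2) diff[OF zero[OF that] that]] by simp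
  next
    case (step2 i)
    have "smult (i - 1) g = smult i g - g" by (simp add: smult_diff_left)
    then show ?case using diff[OF step2(2) that] by simp
  qed
  have "\<exists>f. (f \<in> H \<and> degree f \<le> i \<and> coeff f i \<noteq> 0) \<and>
      (\<forall>g. g \<in> H \<and> degree g \<le> i \<and> coeff g i \<noteq> 0 \<longrightarrow> nat \<bar>coeff f i\<bar> \<le> nat \<bar>coeff g i\<bar>)" if i: "i < N" for i
  proof -
    obtain g where "g \<in> H \<and> degree g \<le> i \<and> coeff g i \<noteq> 0" using full[OF i] by blast
    then show ?thesis by (rule ex_has_least_nat)
  qed
  then obtain f where f: "\<And>i. i < N \<Longrightarrow> f i \<in> H" "\<And>i. i < N \<Longrightarrow> degree (f i) \<le> i"
    "\<And>i. i < N \<Longrightarrow> coeff (f i) i \<noteq> 0"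
    "\<And>i g. i < N \<Longrightarrow> g \<in> H \<Longrightarrow> degree g \<le> i \<Longrightarrow> coeff g i \<noteq> 0 \<Longrightarrow> nat \<bar>coeff (f i) i\<bar> \<le> nat \<bar>coeff g i\<bar>"
    by metis
  have span: "\<exists>c. g = (\<Sum>i<k. smult (c i) (f i))" if "k \<le> N" "g \<in> H" "\<And>j. j \<ge> k \<Longrightarrow> coeff g j = 0" for g k
    using that
  proof (induction k arbitrary: g)
    case 0
    then have "g = 0" by (simp add: poly_eq_iff)
    then show ?case by simp
  next
    case (Suc k)
    define a where "a = coeff (f k) k"
    define g' where "g' = g - smult (coeff g k div a) (f k)"
    have k: "k < N" using Suc.prems(1) by simp
    have a: "a \<noteq> 0" using f(3)[OF k] by (simp add: a_def)
    have g': "g' \<in> H" unfolding g'_def by (intro diff Suc.prems(2) smult f(1) k)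
    have "coeff g j = 0" if "j > k" for j using Suc.prems(3)[of j] that by simp
    then have "degree g \<le> k" by (intro degree_le) auto
    then have deg': "degree g' \<le> k"
      unfolding g'_def using f(2)[OF k] by (intro degree_diff_le order_trans[OF degree_smult_le])
    have mod: "coeff g' k = coeff g k mod a"
      by (simp add: g'_def a_def minus_div_mult_eq_mod[symmetric] mult.commute)
    have "coeff g' k = 0"
    proof (rule ccontr)
      assume "coeff g' k \<noteq> 0"
      then have "nat \<bar>a\<bar> \<le> nat \<bar>coeff g k mod a\<bar>"
        using f(4)[OF k g' deg'] by (simp add: mod a_def)
      then show False using a abs_mod_less[of a "coeff g k"] by simp
    qed
    then have "coeff g' j = 0" if "j \<ge> k" for j
      using that deg' by (cases "j = k") (auto intro: coeff_eq_0)
    then obtain c where c: "g' = (\<Sum>i<k. smult (c i) (f i))" using Suc.IH[OF _ g'] k by auto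
    have "g = (\<Sum>i<Suc k. smult ((c(k := coeff g k div a)) i) (f i))"
      using c by (simp add: g'_def algebra_simps)
    then show ?case by blast
  qed
  have "\<exists>c. g = (\<Sum>i<N. smult (c i) (f i))" if "g \<in> H" for g
    by (rule span[OF order_refl that]) (use deg[OF that] in \<open>auto intro: coeff_eq_0\<close>)
  with f(1-3) show ?thesis by blast
qed

lemma triangular_independent:
  fixes f :: "nat \<Rightarrow> 'a::idom poly"
  assumes "\<And>i. i < n \<Longrightarrow> degree (f i) \<le> i" "\<And>i. i < n \<Longrightarrow> coeff (f i) i \<noteq> 0"
    and "(\<Sum>i<n. smult (c i) (f i)) = 0" "i < n"
  shows "c i = 0"
  using assms
proof (induction n)
  case (Suc n)
  have "coeff (f i) n = 0" if "i < n" for i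
    using Suc.prems(1)[of i] that by (intro coeff_eq_0) simp
  then have "coeff (\<Sum>i<Suc n. smult (c i) (f i)) n = c n * coeff (f n) n"
    by (simp add: coeff_sum)
  then have "c n = 0" using Suc.prems(2)[of n] unfolding Suc.prems(3) by simp
  then show ?case using Suc by (cases "i = n") auto
qed simp

context monic_irreducible
begin

text \<open>Integral elements are g(\<theta>) / M with g in a subgroup of the integer polynomials of
  degree below N. It contains M X^i, so it has a triangular basis; dividing its values at \<theta>
  by M gives an integral basis, and the triangular shape makes the coordinates unique.\<close>

lemma integral_basis_exists:
  assumes M: "M \<noteq> 0" "\<And>x. x \<in> \<O> \<Longrightarrow> of_int M * x \<in> Ztheta"
  obtains b where "integral_basis K b"
proof -
  define H where "H = {g. degree g < N \<and> algebraic_int (ipoly g \<theta> / of_int M)}"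
  have full: "\<exists>g\<in>H. degree g \<le> i \<and> coeff g i \<noteq> 0" if "i < N" for i
  proof (intro bexI conjI)
    show "smult M (monom 1 i) \<in> H"
      using that M(1) algebraic_int_theta
      by (auto simp: H_def degree_monom_eq of_int_hom.map_poly_hom_smult poly_monom)
  qed (use M(1) in \<open>auto simp: degree_monom_eq\<close>)
  have diff: "f - g \<in> H" if "f \<in> H" "g \<in> H" for f g
    using that algebraic_int_diff[of "ipoly f \<theta> / of_int M" "ipoly g \<theta> / of_int M"]
    by (simp add: H_def of_int_poly_simps diff_divide_distrib degree_diff_less)
  have deg: "degree g < N" if "g \<in> H" for g using that by (simp add: H_def)
  obtain f where f_ex: "\<forall>i<N. f i \<in> H \<and> degree (f i) \<le> i \<and> coeff (f i) i \<noteq> 0"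
    "\<forall>g\<in>H. \<exists>c. g = (\<Sum>i<N. smult (c i) (f i))"
    using int_poly_subgroup_triangular_basis[OF diff deg full] by blast
  then have f: "\<And>i. i < N \<Longrightarrow> f i \<in> H" "\<And>i. i < N \<Longrightarrow> degree (f i) \<le> i"
    "\<And>i. i < N \<Longrightarrow> coeff (f i) i \<noteq> 0" "\<And>g. g \<in> H \<Longrightarrow> \<exists>c. g = (\<Sum>i<N. smult (c i) (f i))"
    by simp_all
  define b where "b = map (\<lambda>i. ipoly (f i) \<theta> / of_int M) [0..<N]"
  have comb: "(\<Sum>i<length b. of_int (c i) * b ! i) = ipoly (\<Sum>i<N. smult (c i) (f i)) \<theta> / of_int M" for c
    by (simp add: b_def of_int_poly_hom.hom_sum[of _ "{..<N}"] poly_sum of_int_hom.map_poly_hom_smult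
        sum_divide_distrib)
  have "integral_basis K b"
    unfolding integral_basis_def
  proof (intro conjI ballI)
    show "set b \<subseteq> \<O>"
      using f(1) ipoly_divide_in_K by (auto simp: b_def H_def ring_of_integers_def)
  next
    fix x assume x: "x \<in> \<O>"
    obtain g where g: "of_int M * x = ipoly g \<theta>" "degree g < N"
      using M(2)[OF x] by (rule obtain_reduced_ipoly)
    have x_eq: "x = ipoly g \<theta> / of_int M" using g(1)[symmetric] M(1) by simp
    then have "g \<in> H" using x g(2) by (simp add: H_def ring_of_integers_def)
    then obtain c where c: "g = (\<Sum>i<N. smult (c i) (f i))" using f(4) by blast
    show "\<exists>!c :: int list. length c = length b \<and> x = (\<Sum>i<length b. of_int (c ! i) * b ! i)"
    proof (rule ex1I[of _ "map c [0..<N]"])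
      have "(\<Sum>i<length b. of_int (c i) * b ! i) = x" using comb[of c] c x_eq by simp
      then show "length (map c [0..<N]) = length b \<and> x = (\<Sum>i<length b. of_int (map c [0..<N] ! i) * b ! i)"
        by (simp add: b_def)
    next
      fix d assume d: "length d = length b \<and> x = (\<Sum>i<length b. of_int (d ! i) * b ! i)"
      have "ipoly (\<Sum>i<N. smult (d ! i) (f i)) \<theta> / of_int M = ipoly g \<theta> / of_int M"
        using d comb[of "\<lambda>i. d ! i"] x_eq by metis
      then have "ipoly ((\<Sum>i<N. smult (d ! i) (f i)) - g) \<theta> = 0" using M(1) by (simp add: of_int_poly_simps)
      then have zero: "ipoly (\<Sum>i<N. smult (d ! i - c i) (f i)) \<theta> = 0"
        unfolding c by (simp add: smult_diff_left sum_subtractf)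
      have "degree (smult (d ! i - c i) (f i)) < N" if "i < N" for i
        using f(2)[OF that] that by (intro le_less_trans[OF degree_smult_le]) simp
      then have "degree (\<Sum>i<N. smult (d ! i - c i) (f i)) < N"
        using degree_pos by (intro degree_sum_less) auto
      then have "(\<Sum>i<N. smult (d ! i - c i) (f i)) = 0" using ipoly_eq_0_degree[OF zero] by blast
      then have "d ! i = c i" if "i < N" for i
        using triangular_independent[of N f "\<lambda>i. d ! i - c i" i] f(2,3) that by simp
      then show "d = map c [0..<N]" using d by (intro nth_equalityI) (auto simp: b_def)
    qed
  qed
  then show ?thesis by (rule that)
qed

theorem field_discriminant_eq_iff:
  assumes "M \<noteq> 0" "\<And>x. x \<in> \<O> \<Longrightarrow> of_int M * x \<in> Ztheta"
  shows "monic_discriminant (of_int_poly \<Phi>) = field_discriminant K \<longleftrightarrow> \<O> = Ztheta"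
proof -
  obtain b where "integral_basis K b" using integral_basis_exists[OF assms] .
  then have "integral_basis K (SOME b. integral_basis K b)" by (rule someI)
  then show ?thesis unfolding field_discriminant_def Let_def by (rule discriminant_eq_iff)
qed

end

section \<open>Integral elements outside the order generated by a root\<close>

lemma int_coprime_combination:
  fixes a p :: int and z :: complex
  assumes "coprime a p" "algebraic_int (of_int a * z)" "algebraic_int (of_int p * z)"
  shows "algebraic_int z"
proof -
  obtain u v where uv: "u * a + v * p = 1"
    using bezout_int[of a p] assms(1) by (auto simp: coprime_iff_gcd_eq_1)
  have "z = of_int (u * a + v * p) * z" unfolding uv by simp
  also have "\<dots> = of_int u * (of_int a * z) + of_int v * (of_int p * z)" by (simp add: algebra_simps)
  finally show ?thesis using assms(2,3) by (metis algebraic_int_add algebraic_int_mult algebraic_int_of_int)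
qed

lemma algebraic_int_if_square:
  "algebraic_int (z\<^sup>2) \<Longrightarrow> algebraic_int (z :: complex)"
  using algebraic_int_quadratic[of 0 "z\<^sup>2" z] by simp

text \<open>Here k is the index of the lowest coefficient not divisible by p; the terms below it go
  into \<open>smult p G1\<close>.\<close>

lemma poly_not_divisible_decompose:
  fixes G :: "int poly"
  assumes "\<not> [:p:] dvd G"
  shows "\<exists>k c G1 G2. \<not> p dvd c \<and> k \<le> degree G \<and> G = smult p G1 + monom 1 k * pCons c G2"
  using assms
proof (induction G)
  case (pCons a G)
  show ?case
  proof (cases "p dvd a")
    case False
    then show ?thesis by (intro exI[of _ 0] exI[of _ a] exI[of _ 0] exI[of _ G]) simp
  next
    case True
    then obtain a' where a': "a = p * a'" by blast
    have "\<not> [:p:] dvd G"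
    proof
      assume "[:p:] dvd G"
      then obtain G' where "G = [:p:] * G'" by (rule dvdE)
      then have "pCons a G = [:p:] * pCons a' G'" by (simp add: a')
      then show False using pCons.prems by (metis dvd_triv_left)
    qed
    then obtain k c G1 G2 where IH: "\<not> p dvd c" "k \<le> degree G" "G = smult p G1 + monom 1 k * pCons c G2"
      using pCons.IH by blast
    have nz: "G \<noteq> 0" using \<open>\<not> [:p:] dvd G\<close> by auto
    have "pCons a G = smult p (pCons a' G1) + monom 1 (Suc k) * pCons c G2"
      by (subst IH(3)) (simp add: a' monom_Suc)
    moreover have "Suc k \<le> degree (pCons a G)" using nz IH(2) by simp
    ultimately show ?thesis using IH(1) by blast
  qed
qed simp

section \<open>Primes at which the order is maximal\<close>

context monic_irreducible
begin

lemma ipoly_in_Ztheta: "ipoly g \<theta> \<in> Ztheta"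
  by (simp add: Ztheta_def)

lemma Ztheta_diff: "x \<in> Ztheta \<Longrightarrow> y \<in> Ztheta \<Longrightarrow> x - y \<in> Ztheta"
  using ipoly_in_Ztheta[of "_ - _"] by (auto simp: Ztheta_def of_int_poly_simps)

lemma Ztheta_mult: "x \<in> Ztheta \<Longrightarrow> y \<in> Ztheta \<Longrightarrow> x * y \<in> Ztheta"
  using ipoly_in_Ztheta[of "_ * _"] by (auto simp: Ztheta_def of_int_poly_simps)

lemma Ztheta_of_int: "of_int k \<in> Ztheta"
  using ipoly_in_Ztheta[of "[:k:]"] by (simp add: of_int_poly_simps)

lemma O_algebraic_int: "x \<in> \<O> \<Longrightarrow> algebraic_int x"
  by (simp add: ring_of_integers_def)

lemma O_mult: "x \<in> \<O> \<Longrightarrow> y \<in> \<O> \<Longrightarrow> x * y \<in> \<O>"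
  using complex_subfieldD(4)[OF complex_subfield_rat_adjoin] by (auto simp: ring_of_integers_def)

lemma O_power: "x \<in> \<O> \<Longrightarrow> x ^ k \<in> \<O>"
  by (induction k) (use ipoly_in_O[of 1] O_mult in auto)

text \<open>If m is the order of the class of x in \<O> modulo Z[\<theta>], then m divides M, and
  for a prime q dividing m the class of (m/q) x has order q.\<close>

lemma O_prime_witness:
  assumes M: "M \<noteq> 0" "\<And>x. x \<in> \<O> \<Longrightarrow> of_int M * x \<in> Ztheta" and "\<O> \<noteq> Ztheta"
  obtains p x where "prime p" "p dvd M" "x \<in> \<O>" "x \<notin> Ztheta" "of_int p * x \<in> Ztheta"
proof -
  obtain x where x: "x \<in> \<O>" "x \<notin> Ztheta" using assms(3) Ztheta_subset by blast
  define P where "P m \<longleftrightarrow> m > 0 \<and> of_nat m * x \<in> Ztheta" for m :: nat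
  define m where "m = (LEAST m. P m)"
  have "of_int (sgn M) * (of_int M * x) \<in> Ztheta"
    by (rule Ztheta_mult[OF Ztheta_of_int M(2)[OF x(1)]])
  moreover have "of_int (sgn M) * (of_int M * x) = of_nat (nat \<bar>M\<bar>) * x"
  proof -
    have "of_int (sgn M) * (of_int M * x) = of_int (sgn M * M) * x" by simp
    also have "sgn M * M = int (nat \<bar>M\<bar>)" by (simp add: sgn_mult_abs[symmetric] sgn_if)
    finally show ?thesis by simp
  qed
  ultimately have "P (nat \<bar>M\<bar>)" using M(1) by (simp only: P_def) simp
  then have Pm: "P m" unfolding m_def by (rule LeastI)
  have least: "\<not> P k" if "k < m" for k using that unfolding m_def by (rule not_less_Least)
  have m: "m > 0" "of_nat m * x \<in> Ztheta" using Pm by (auto simp: P_def)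
  have "M mod int m = 0"
  proof (rule ccontr)
    assume nz: "M mod int m \<noteq> 0"
    have pos: "0 \<le> M mod int m" "M mod int m < int m" using m(1) by auto
    have "of_int M * x - of_int (M div int m) * (of_nat m * x) \<in> Ztheta"
      by (intro Ztheta_diff Ztheta_mult Ztheta_of_int m(2) M(2) x(1))
    moreover have "of_int M * x - of_int (M div int m) * (of_nat m * x) = of_int (M - M div int m * int m) * x"
      by (simp add: left_diff_distrib)
    moreover have "M - M div int m * int m = int (nat (M mod int m))"
      using pos(1) by (simp add: minus_div_mult_eq_mod)
    ultimately have "P (nat (M mod int m))" using nz pos(1) by (simp add: P_def)
    moreover have "nat (M mod int m) < m" using pos m(1) by (simp add: nat_less_iff)
    ultimately show False using least by blast
  qed
  then have mM: "int m dvd M" by (simp add: dvd_eq_mod_eq_0)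
  have "m \<noteq> 1" using m(2) x(2) by auto
  then obtain q where q: "prime q" "q dvd m" using prime_factor_nat by blast
  then obtain j where j: "m = q * j" by blast
  have jm: "0 < j" "j < m" using m(1) q(1) prime_gt_1_nat[of q] by (auto simp: j)
  show ?thesis
  proof (rule that[of "int q" "of_nat j * x"])
    show "prime (int q)" using q(1) by simp
    show "int q dvd M" using q(2) mM dvd_trans of_nat_dvd_iff by blast
    show "of_nat j * x \<in> \<O>" using O_mult[OF ipoly_in_O[of "[:int j:]"] x(1)] by (simp add: of_int_poly_simps)
    show "of_nat j * x \<notin> Ztheta" using least[OF jm(2)] jm(1) by (simp add: P_def)
    show "of_int (int q) * (of_nat j * x) \<in> Ztheta" using m(2) by (simp add: j mult.assoc)
  qed
qed

text \<open>The conductor bounds all powers of \<open>g(\<theta>)/p\<close> at once, so \<open>g\<close> is nilpotent modulo \<open>p\<close>.\<close>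

lemma integral_quotient_nilpotent:
  assumes M: "M \<noteq> 0" "\<And>x. x \<in> \<O> \<Longrightarrow> of_int M * x \<in> Ztheta"
    and p: "prime p" and x: "algebraic_int (ipoly g \<theta> / of_int p)"
  obtains k M' Q E where "k > 0" "coprime M' p" "smult M' (g ^ k) = smult p Q + \<Phi> * E"
proof -
  have p0: "p \<noteq> 0" using p by auto
  have "\<not> is_unit p" using p not_prime_unit by meson
  then have "\<exists>a M'. M = p ^ a * M' \<and> \<not> p dvd M'"
    using M(1) by (meson multiplicity_decompose' mult.commute)
  then obtain a M' where M': "M = p ^ a * M'" "\<not> p dvd M'" by (elim exE conjE)
  have "ipoly g \<theta> / of_int p \<in> \<O>" using x ipoly_divide_in_K by (simp add: ring_of_integers_def)
  \<comment> \<open>The exponent exceeds the power of p in M by one, so exactly one factor p remains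
    in the denominator.\<close>
  then have "of_int M * (ipoly g \<theta> / of_int p) ^ Suc a \<in> Ztheta" by (intro M(2) O_power)
  then obtain Q where Q: "of_int M * (ipoly g \<theta> / of_int p) ^ Suc a = ipoly Q \<theta>" by (auto simp: Ztheta_def)
  have "of_int M' * ipoly g \<theta> ^ Suc a = of_int p * ipoly Q \<theta>"
    unfolding Q[symmetric] M'(1) using p0 by (simp add: power_divide)
  then have "ipoly (smult M' (g ^ Suc a) - smult p Q) \<theta> = 0"
    by (simp add: of_int_poly_simps del: power_Suc)
  then obtain E where "smult M' (g ^ Suc a) - smult p Q = \<Phi> * E" by (rule ipoly_eq_0_obtain)
  then have "smult M' (g ^ Suc a) = smult p Q + \<Phi> * E" by (simp add: algebra_simps)
  moreover have "coprime M' p" using prime_imp_coprime[OF p M'(2)] by (subst coprime_commute)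
  ultimately show ?thesis by (intro that[of "Suc a"]) auto
qed

lemma tame_prime:
  assumes M: "M \<noteq> 0" "\<And>x. x \<in> \<O> \<Longrightarrow> of_int M * x \<in> Ztheta"
    and p: "prime p" and u: "coprime u p"
    and \<Phi>: "\<Phi> = L * R\<^sup>2 - [:p * u:]" and monic_LR: "lead_coeff (L * R) = 1"
    and bezout: "A * (L * R) + B * pderiv (L * R) = [:e:]" "coprime e p"
    and x: "x \<in> \<O>" "of_int p * x \<in> Ztheta"
  shows "x \<in> Ztheta"
proof -
  have p0: "p \<noteq> 0" using p by auto
  define F where "F = L * R"
  obtain g where g: "of_int p * x = ipoly g \<theta>" using x(2) by (auto simp: Ztheta_def)
  then have x_eq: "x = ipoly g \<theta> / of_int p" using p0 by (simp add: field_simps)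
  \<comment> \<open>By nilpotency M' w^k lies in the ideal (p, \<Phi>). At a root a of L R one has
    \<Phi>(a) = -p u, so w(a)^k / p is integral since M' is prime to p; separability then makes L R
    divide w modulo p.\<close>
  have rad: "\<exists>Q H. w = F * Q + smult p H" if w: "algebraic_int (ipoly w \<theta> / of_int p)" for w
  proof -
    obtain k M' Q E where k: "k > 0" "coprime M' p" "smult M' (w ^ k) = smult p Q + \<Phi> * E"
      using integral_quotient_nilpotent[OF M p w] .
    have "algebraic_int (ipoly w a ^ k / of_int p)" if a: "ipoly (L * R) a = 0" for a
    proof (rule int_coprime_combination[OF k(2)])
      have alg: "algebraic_int a" using algebraic_int_root_of_monic[OF monic_LR a] .
      have \<Phi>a: "ipoly \<Phi> a = - of_int (p * u)"
        using a by (simp add: \<Phi> of_int_poly_simps power2_eq_square)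
      have "of_int M' * ipoly w a ^ k = of_int p * ipoly Q a + ipoly \<Phi> a * ipoly E a"
        using arg_cong[OF k(3), of "\<lambda>f. ipoly f a"] by (simp add: of_int_poly_simps)
      also have "\<dots> = of_int p * (ipoly Q a - of_int u * ipoly E a)"
        unfolding \<Phi>a by (simp add: right_diff_distrib)
      finally have "of_int M' * ipoly w a ^ k = of_int p * (ipoly Q a - of_int u * ipoly E a)" .
      then have "of_int M' * (ipoly w a ^ k / of_int p) = ipoly Q a - of_int u * ipoly E a"
        using p0 by simp
      then show "algebraic_int (of_int M' * (ipoly w a ^ k / of_int p))" using alg by auto
      show "algebraic_int (of_int p * (ipoly w a ^ k / of_int p))" using alg p0 by auto
    qed
    then show ?thesis
      using separable_mod_dvd[OF monic_LR p k(1) bezout] unfolding F_def by metis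
  qed
  have LRR: "ipoly L \<theta> * (ipoly R \<theta>)\<^sup>2 = of_int (p * u)"
    using root by (simp add: \<Phi> of_int_poly_simps)
  have "algebraic_int (ipoly g \<theta> / of_int p)" using x(1) x_eq by (simp add: ring_of_integers_def)
  then obtain k h where k: "g = F * k + smult p h" using rad by blast
  define y where "y = ipoly (F * k) \<theta> / of_int p"
  have "ipoly g \<theta> = ipoly (F * k) \<theta> + of_int p * ipoly h \<theta>"
    unfolding k by (simp add: of_int_poly_simps)
  then have y_eq: "y = x - ipoly h \<theta>"
    unfolding y_def x_eq using p0 by (simp add: add_divide_distrib)
  have y: "algebraic_int y"
    unfolding y_eq using O_algebraic_int[OF x(1)] O_algebraic_int[OF ipoly_in_O] by blast
  \<comment> \<open>Since L R^2 takes the value p u at \<theta>, y^2 equals u times this quotient,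
    and u is prime to p.\<close>
  have "algebraic_int (ipoly (L * k\<^sup>2) \<theta> / of_int p)"
  proof (rule int_coprime_combination[OF u])
    have "y\<^sup>2 = (ipoly L \<theta> * (ipoly R \<theta>)\<^sup>2) * (ipoly L \<theta> * (ipoly k \<theta>)\<^sup>2) / of_int p ^ 2"
      by (simp add: y_def F_def of_int_poly_simps power_divide power_mult_distrib power2_eq_square mult_ac)
    also have "\<dots> = of_int u * (ipoly (L * k\<^sup>2) \<theta> / of_int p)"
      unfolding LRR using p0 by (simp add: of_int_poly_simps power2_eq_square)
    finally show "algebraic_int (of_int u * (ipoly (L * k\<^sup>2) \<theta> / of_int p))" using y by (metis algebraic_int_power)
    show "algebraic_int (of_int p * (ipoly (L * k\<^sup>2) \<theta> / of_int p))"
      using O_algebraic_int[OF ipoly_in_O] p0 by simp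
  qed
  then obtain Q H where QH: "L * k\<^sup>2 = F * Q + smult p H" using rad by blast
  \<comment> \<open>The second use of \<open>rad\<close> makes L k^2 divisible by p at the roots of
    L R, hence also (L k)^2. Thus L R divides L k modulo p, and multiplying by R introduces L R^2,
    whose value at \<theta> is divisible by p.\<close>
  have "algebraic_int (ipoly (L * k) a ^ 2 / of_int p)" if a: "ipoly (L * R) a = 0" for a
  proof -
    have "ipoly (L * k) a ^ 2 = ipoly L a * ipoly (L * k\<^sup>2) a"
      by (simp add: of_int_poly_simps power2_eq_square)
    also have "\<dots> = of_int p * (ipoly L a * ipoly H a)"
      unfolding QH using a by (simp add: F_def of_int_poly_simps)
    finally have "ipoly (L * k) a ^ 2 / of_int p = ipoly L a * ipoly H a" using p0 by simp
    then show ?thesis using algebraic_int_root_of_monic[OF monic_LR a] by auto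
  qed
  then obtain Q' H' where QH': "L * k = L * R * Q' + smult p H'"
    using separable_mod_dvd[OF monic_LR p _ bezout, of 2 "L * k"] by (metis zero_less_numeral)
  have "F * k = R * (L * k)" by (simp add: F_def mult_ac)
  also have "\<dots> = L * R\<^sup>2 * Q' + smult p (R * H')"
    unfolding QH' by (simp add: algebra_simps power2_eq_square)
  finally have "ipoly (F * k) \<theta> = ipoly L \<theta> * (ipoly R \<theta>)\<^sup>2 * ipoly Q' \<theta> + of_int p * ipoly (R * H') \<theta>"
    by (simp add: of_int_poly_simps)
  then have "y = ipoly (smult u Q' + R * H') \<theta>"
    unfolding LRR y_def using p0 by (simp add: of_int_poly_simps add_divide_distrib)
  moreover have "x = y + ipoly h \<theta>" unfolding y_eq by simp
  ultimately have "x = ipoly (smult u Q' + R * H' + h) \<theta>" by (simp add: of_int_poly_simps)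
  then show ?thesis by (auto simp: Ztheta_def)
qed

lemma prod_roots_diff: "(\<Prod>a\<in>roots. of_int t - a) = of_int (poly \<Phi> t)"
proof -
  have "of_int (poly \<Phi> t) = ipoly \<Phi> (of_int t)" by (simp add: of_int_hom.poly_map_poly)
  also have "\<dots> = poly (\<Prod>a\<in>roots. [:- a, 1:]) (of_int t)"
    using complex_poly_decompose_rsquarefree[OF Phi_rsquarefree] monic by (simp add: roots_def)
  finally show ?thesis by (simp add: poly_prod)
qed

text \<open>Put \<alpha> = \<theta> - t, so that \<alpha>^N is divisible by p. If the numerator of
  x, written in \<alpha>, has lowest coefficient c prime to p, at \<alpha>^k, then multiplying by
  \<alpha>^(N-1-k) makes c \<alpha>^(N-1) / p integral. Its norm is c^N \<Phi>(t)^(N-1) / p^N up to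
  sign, which is not an integer when p divides \<Phi>(t) exactly once.\<close>

lemma wild_prime:
  assumes p: "prime p" and \<Phi>: "\<Phi> = [:- t, 1:] ^ N + smult p h" and pt: "\<not> p\<^sup>2 dvd poly \<Phi> t"
    and x: "x \<in> \<O>" "of_int p * x \<in> Ztheta"
  shows "x \<in> Ztheta"
proof (rule ccontr)
  assume nx: "x \<notin> Ztheta"
  have p0: "p \<noteq> 0" using p by auto
  obtain g where g: "of_int p * x = ipoly g \<theta>" "degree g < N" using x(2) by (rule obtain_reduced_ipoly)
  define G where "G = pcompose g [:t, 1:]"
  define \<alpha> where "\<alpha> = \<theta> - of_int t"
  have gG: "g = pcompose G [:- t, 1:]"
    unfolding G_def by (simp add: pcompose_assoc[symmetric] pcompose_pCons)
  have eval: "ipoly (pcompose f [:- t, 1:]) \<theta> = ipoly f \<alpha>" for f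
    by (simp add: \<alpha>_def of_int_hom.map_poly_pcompose poly_pcompose of_int_poly_simps)
  have \<alpha>: "algebraic_int \<alpha>" using algebraic_int_theta by (auto simp: \<alpha>_def)
  have "\<not> [:p:] dvd G"
  proof
    assume "[:p:] dvd G"
    then obtain G' where G': "G = smult p G'" by (auto elim: dvdE)
    have "of_int p * x = of_int p * ipoly (pcompose G' [:- t, 1:]) \<theta>"
      unfolding g(1) gG eval G' by (simp add: of_int_poly_simps)
    then have "x = ipoly (pcompose G' [:- t, 1:]) \<theta>" using p0 by simp
    then show False using nx ipoly_in_Ztheta by simp
  qed
  then obtain k c G1 G2 where dec: "\<not> p dvd c" "k \<le> degree G" "G = smult p G1 + monom 1 k * pCons c G2"
    using poly_not_divisible_decompose by blast
  have "degree G = degree g" by (simp add: G_def degree_pcompose)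
  then have k: "k + (N - 1 - k) = N - 1" "k + (N - 1 - k) + 1 = N" using dec(2) g(2) by auto
  have \<alpha>N: "\<alpha> ^ N = - of_int p * ipoly h \<theta>"
    using root arg_cong[OF \<Phi>, of "\<lambda>f. ipoly f \<theta>"]
    by (simp add: of_int_poly_simps \<alpha>_def eq_neg_iff_add_eq_0)
  have "of_int p * x = of_int p * ipoly G1 \<alpha> + \<alpha> ^ k * (of_int c + \<alpha> * ipoly G2 \<alpha>)"
    unfolding g(1) gG eval by (subst dec(3)) (simp add: of_int_poly_simps of_int_hom.map_poly_hom_monom poly_monom distrib_left mult.left_commute)
  then have "\<alpha> ^ (N - 1 - k) * (of_int p * x)
    = \<alpha> ^ (N - 1 - k) * (of_int p * ipoly G1 \<alpha>) + \<alpha> ^ (k + (N - 1 - k)) * of_int c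
      + \<alpha> ^ (k + (N - 1 - k) + 1) * ipoly G2 \<alpha>"
    by (simp add: algebra_simps power_add)
  then have "of_int c * \<alpha> ^ (N - 1) = of_int p * (\<alpha> ^ (N - 1 - k) * (x - ipoly G1 \<alpha>) + ipoly h \<theta> * ipoly G2 \<alpha>)"
    unfolding k(2) unfolding k(1) \<alpha>N by (simp add: algebra_simps)
  then have "of_int c * \<alpha> ^ (N - 1) / of_int p = \<alpha> ^ (N - 1 - k) * (x - ipoly G1 \<alpha>) + ipoly h \<theta> * ipoly G2 \<alpha>"
    using p0 by simp
  moreover have "algebraic_int (\<alpha> ^ (N - 1 - k) * (x - ipoly G1 \<alpha>) + ipoly h \<theta> * ipoly G2 \<alpha>)"
    using \<alpha> O_algebraic_int[OF x(1)] algebraic_int_theta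
    by (intro algebraic_int_add algebraic_int_mult algebraic_int_diff algebraic_int_power algebraic_int_poly_of_int)
  ultimately have "algebraic_int (ipoly (smult c ([:- t, 1:] ^ (N - 1))) \<theta> / of_int p)"
    by (simp add: of_int_poly_simps \<alpha>_def)
  then have "algebraic_int ((\<Prod>a\<in>roots. ipoly (smult c ([:- t, 1:] ^ (N - 1))) a) / of_int p ^ N)"
    by (rule algebraic_int_norm)
  moreover have "(\<Prod>a\<in>roots. ipoly (smult c ([:- t, 1:] ^ (N - 1))) a)
    = of_int (c ^ N * ((- 1) ^ N * poly \<Phi> t) ^ (N - 1))"
  proof -
    have "(\<Prod>a\<in>roots. a - of_int t) = (\<Prod>a\<in>roots. - 1 * (of_int t - a))" by simp
    also have "\<dots> = (- 1) ^ N * of_int (poly \<Phi> t)"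
      unfolding prod.distrib prod_roots_diff by (simp add: card_roots)
    finally have prod: "(\<Prod>a\<in>roots. a - of_int t) = (- 1) ^ N * of_int (poly \<Phi> t)" .
    have "(\<Prod>a\<in>roots. ipoly (smult c ([:- t, 1:] ^ (N - 1))) a)
      = (\<Prod>a\<in>roots. of_int c * (a - of_int t) ^ (N - 1))"
      by (simp add: of_int_poly_simps)
    also have "\<dots> = of_int c ^ N * (\<Prod>a\<in>roots. a - of_int t) ^ (N - 1)"
      unfolding prod.distrib prod_power_distrib by (simp add: card_roots)
    finally show ?thesis unfolding prod by simp
  qed
  ultimately have "algebraic_int (of_int (c ^ N * ((- 1) ^ N * poly \<Phi> t) ^ (N - 1)) / of_int (p ^ N) :: complex)"
    by simp
  then have dvd: "p ^ N dvd c ^ N * ((- 1) ^ N * poly \<Phi> t) ^ (N - 1)"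
    by (rule dvd_if_algebraic_int_divide) (use p0 in simp)
  define v where "v = poly h t"
  have N: "N = Suc (N - 1)" using degree_pos by simp
  have \<Phi>t: "poly \<Phi> t = p * v"
    using arg_cong[OF \<Phi>, of "\<lambda>f. poly f t"] degree_pos by (simp add: v_def zero_power)
  have "c ^ N * ((- 1) ^ N * poly \<Phi> t) ^ (N - 1) = p ^ (N - 1) * (c ^ N * ((- 1) ^ N * v) ^ (N - 1))"
    by (simp only: \<Phi>t power_mult_distrib mult_ac)
  moreover have "p ^ N = p ^ (N - 1) * p" by (subst N) simp
  ultimately have "p ^ (N - 1) * p dvd p ^ (N - 1) * (c ^ N * ((- 1) ^ N * v) ^ (N - 1))"
    using dvd by argo
  then have "p dvd c ^ N * ((- 1) ^ N * v) ^ (N - 1)"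
    using p0 by (subst (asm) dvd_mult_cancel_left) simp
  then have "p dvd c \<or> p dvd (- 1) ^ N * v" using p prime_dvd_mult_iff prime_dvd_power by blast
  moreover have "\<not> p dvd v" using pt by (auto simp: \<Phi>t power2_eq_square)
  ultimately show False using dec(1) p by (auto simp: minus_one_power_iff split: if_splits)
qed

section \<open>Obstructions to maximality\<close>

lemma monic_divide_notin_Ztheta:
  assumes "lead_coeff P = 1" "degree P < N" "\<not> is_unit m" "m \<noteq> 0"
  shows "ipoly P \<theta> / of_int m \<notin> Ztheta"
proof
  assume "ipoly P \<theta> / of_int m \<in> Ztheta"
  then obtain f where f: "ipoly P \<theta> / of_int m = ipoly f \<theta>" "degree f < N" by (rule obtain_reduced_ipoly)
  then have "ipoly (P - smult m f) \<theta> = 0" using assms(4) by (simp add: of_int_poly_simps field_simps)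
  moreover have "degree (P - smult m f) < N"
    using assms(2) f(2) by (intro degree_diff_less le_less_trans[OF degree_smult_le]) auto
  ultimately have "P - smult m f = 0" by (rule ipoly_eq_0_degree)
  \<comment> \<open>Reduced numerators are unique, so m would divide the leading coefficient
    1.\<close>
  then have "coeff P (degree P) = m * coeff f (degree P)" by simp
  then show False using assms(1,3) by (metis dvd_triv_left)
qed

text \<open>The witness y is the value of L R at \<theta> divided by m; its square is L(\<theta>)
  times the integer w / m^2.\<close>

lemma O_neq_if_square_divides:
  assumes \<Phi>: "\<Phi> = L * R\<^sup>2 - [:w:]" and m: "m\<^sup>2 dvd w" "\<not> is_unit m" "m \<noteq> 0"
    and LR: "lead_coeff (L * R) = 1" "degree (L * R) < N"
  shows "\<O> \<noteq> Ztheta"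
proof -
  define y where "y = ipoly (L * R) \<theta> / of_int m"
  obtain v where v: "w = m\<^sup>2 * v" using m(1) by blast
  have "ipoly L \<theta> * (ipoly R \<theta>)\<^sup>2 = of_int w" using root by (simp add: \<Phi> of_int_poly_simps)
  moreover have "y\<^sup>2 = ipoly L \<theta> * (ipoly L \<theta> * (ipoly R \<theta>)\<^sup>2) / of_int m ^ 2"
    by (simp add: y_def of_int_poly_simps power_divide power2_eq_square mult_ac)
  ultimately have "y\<^sup>2 = ipoly L \<theta> * of_int v" using m(3) by (simp add: v)
  then have "algebraic_int (y\<^sup>2)" using O_algebraic_int[OF ipoly_in_O] by auto
  then have "y \<in> \<O>" using algebraic_int_if_square ipoly_divide_in_K by (simp add: ring_of_integers_def y_def)
  moreover have "y \<notin> Ztheta" unfolding y_def using LR m(2,3) by (rule monic_divide_notin_Ztheta)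
  ultimately show ?thesis by blast
qed

text \<open>The witness is z = Q(\<theta>) / p with Q = (\<Phi> - \<Phi>(t)) / (X - t). It is a root
  of a monic quadratic over Z[\<theta>], since (\<theta> - t) Q(\<theta>) = -\<Phi>(t) is divisible
  by p^2.\<close>

lemma O_neq_if_totally_ramified_square:
  assumes p: "prime p" and \<Phi>: "\<Phi> = [:- t, 1:] ^ N + smult p h" and pt: "p\<^sup>2 dvd poly \<Phi> t" and N: "N \<ge> 2"
  shows "\<O> \<noteq> Ztheta"
proof -
  have p0: "p \<noteq> 0" using p by auto
  define Y where "Y = [:- t, 1:]"
  have "Y dvd h - [:poly h t:]" unfolding Y_def by (simp flip: poly_eq_0_iff_dvd)
  then obtain w where "h - [:poly h t:] = Y * w" by blast
  then have w: "h = [:poly h t:] + Y * w" by (simp add: algebra_simps)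
  define Q where "Q = Y ^ (N - 1) + smult p w"
  have \<Phi>t: "poly \<Phi> t = p * poly h t"
    using arg_cong[OF \<Phi>, of "\<lambda>f. poly f t"] N by (simp add: zero_power)
  then have "p dvd poly h t" using pt p0 by (simp add: power2_eq_square)
  then obtain v where v: "poly h t = p * v" by blast
  have YN: "Y ^ N = Y * Y ^ (N - 1)" "Y ^ (N - 1) = Y * Y ^ (N - 2)"
  proof -
    have "N = Suc (N - 1)" "N - 1 = Suc (N - 2)" using N by auto
    then show "Y ^ N = Y * Y ^ (N - 1)" "Y ^ (N - 1) = Y * Y ^ (N - 2)" by (metis power_Suc)+
  qed
  have "\<Phi> = Y * Y ^ (N - 1) + smult p ([:poly h t:] + Y * w)"
    unfolding YN(1)[symmetric] w[symmetric] unfolding Y_def by (rule \<Phi>)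
  then have YQ: "Y * Q = \<Phi> - [:p * p * v:]"
    by (simp add: Q_def v distrib_left smult_add_right mult.assoc)
  have deg: "degree (\<Phi> - [:p * p * v:]) = N" and lead: "lead_coeff (\<Phi> - [:p * p * v:]) = 1"
  proof -
    show deg: "degree (\<Phi> - [:p * p * v:]) = N"
      unfolding diff_conv_add_uminus using degree_pos by (intro degree_add_eq_left) simp
    show "lead_coeff (\<Phi> - [:p * p * v:]) = 1"
      unfolding deg using monic degree_pos by (simp add: coeff_pCons split: nat.splits)
  qed
  have "Y \<noteq> 0" "degree Y = 1" "lead_coeff Y = 1" by (simp_all add: Y_def)
  moreover have "Q \<noteq> 0" using YQ deg degree_pos by auto
  ultimately have degQ: "degree Q < N" and leadQ: "lead_coeff Q = 1"
    using deg lead lead_coeff_mult[of Y Q] unfolding YQ[symmetric]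
    by (simp_all add: degree_mult_eq del: coeff_mult_degree_sum)
  define \<alpha> where "\<alpha> = ipoly Y \<theta>"
  define z where "z = ipoly Q \<theta> / of_int p"
  have \<alpha>: "\<alpha> * ipoly Q \<theta> = - of_int (p * p * v)"
    using arg_cong[OF YQ, of "\<lambda>f. ipoly f \<theta>"] root by (simp add: of_int_poly_simps \<alpha>_def)
  have "ipoly Q \<theta> = \<alpha> * \<alpha> ^ (N - 2) + of_int p * ipoly w \<theta>"
    unfolding Q_def YN(2) by (simp add: of_int_poly_simps \<alpha>_def)
  \<comment> \<open>One factor of Q(\<theta>)^2 is expanded as \<alpha> \<alpha>^(N-2) + p
    w(\<theta>), so that \<alpha> meets the other factor.\<close>
  moreover have "q\<^sup>2 = (\<alpha> * q) * A + P * W * q" if "q = \<alpha> * A + P * W" for q A P W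
    using that by (simp add: power2_eq_square algebra_simps)
  ultimately have "(ipoly Q \<theta>)\<^sup>2 = - of_int (p * p * v) * \<alpha> ^ (N - 2) + of_int p * ipoly w \<theta> * ipoly Q \<theta>"
    unfolding \<alpha>[symmetric] by blast
  moreover have "of_int p * z = ipoly Q \<theta>" using p0 by (simp add: z_def)
  ultimately have pz: "(of_int p * z)\<^sup>2 = - of_int (p * p * v) * \<alpha> ^ (N - 2) + of_int p * ipoly w \<theta> * (of_int p * z)"
    by simp
  have "(of_int p)\<^sup>2 * z\<^sup>2 = (of_int p * z)\<^sup>2" by (rule power_mult_distrib[symmetric])
  also have "\<dots> = (of_int p)\<^sup>2 * (ipoly w \<theta> * z + (- of_int v * \<alpha> ^ (N - 2)))"
  proof -
    have "- (P * P * V) * A + P * W * (P * x) = P\<^sup>2 * (W * x + (- V * A))" for P V A W x :: complex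
      by (simp add: power2_eq_square algebra_simps)
    then show ?thesis unfolding pz of_int_mult .
  qed
  finally have "(of_int p)\<^sup>2 * z\<^sup>2 = (of_int p)\<^sup>2 * (ipoly w \<theta> * z + (- of_int v * \<alpha> ^ (N - 2)))" .
  then have "z\<^sup>2 = ipoly w \<theta> * z + (- of_int v * \<alpha> ^ (N - 2))"
    using p0 by simp
  moreover have "algebraic_int (ipoly w \<theta>)" "algebraic_int (- of_int v * \<alpha> ^ (N - 2))"
    using O_algebraic_int[OF ipoly_in_O] unfolding \<alpha>_def by auto
  ultimately have "algebraic_int z" by (rule algebraic_int_quadratic[rotated 2])
  then have "z \<in> \<O>" using ipoly_divide_in_K by (simp add: ring_of_integers_def z_def)
  moreover have "z \<notin> Ztheta"
    unfolding z_def using leadQ degQ p0 not_prime_unit[of p] p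
    by (intro monic_divide_notin_Ztheta) auto
  ultimately show ?thesis by blast
qed

end

section \<open>Iterated Chebyshev polynomials\<close>

locale chebyshev_prime_power =
  fixes l n k d :: nat and t :: int and \<theta> :: complex
  assumes l: "prime l" "odd l" and n: "n > 0" and d: "d = l ^ n" "d = 2 * k + 1"
    and irred: "irreducible (of_int_poly (chebyshev_T d - [:t:]) :: rat poly)"
    and root: "ipoly (chebyshev_T d - [:t:]) \<theta> = 0"
begin

lemma d_gt_1: "d > 1"
  unfolding d(1) using l(1) n by (intro one_less_power prime_gt_1_nat)

lemma degree_Phi: "degree (chebyshev_T d - [:t:]) = d"
  unfolding diff_conv_add_uminus using degree_chebyshev_T[of d] d_gt_1
  by (subst degree_add_eq_left) simp_all

lemma monic_Phi: "lead_coeff (chebyshev_T d - [:t:]) = 1"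
  unfolding degree_Phi using chebyshev_T_monic(1)[of d] degree_chebyshev_T[of d] d_gt_1
  by (simp add: coeff_pCons split: nat.splits)

sublocale monic_irreducible "chebyshev_T d - [:t:]" \<theta>
  using monic_Phi irred root by unfold_locales

abbreviation "\<Phi> \<equiv> chebyshev_T d - [:t:]"

lemma Phi_eq:
  assumes "e * e = 1"
  shows "\<Phi> = [:- 2 * e, 1:] * (cheb_half e k)\<^sup>2 - [:t - 2 * e:]"
  unfolding d(2) chebyshev_T_odd[OF assms] by simp

text \<open>Otherwise \<Phi> would have the rational root 2e, although it is irreducible of degree d
  > 1.\<close>

lemma t_neq:
  assumes "e * e = 1"
  shows "t - 2 * e \<noteq> 0"
proof
  assume t: "t - 2 * e = 0"
  have "ipoly \<Phi> (of_int (2 * e)) = of_int (poly \<Phi> (2 * e))" by (rule of_int_hom.poly_map_poly)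
  also have "\<dots> = 0" using t by (subst Phi_eq[OF assms]) simp
  finally have "of_int (2 * e) \<in> roots" by (simp add: roots_def)
  moreover have "rpoly [:- of_int (2 * e), 1:] (of_int (2 * e)) = 0"
    by (simp add: of_rat_hom.map_poly_pCons_hom of_rat_minus of_rat_mult)
  ultimately have "of_int_poly \<Phi> dvd [:- of_int (2 * e), 1:: rat:]" using rpoly_eq_0_iff by blast
  then have "degree (of_int_poly \<Phi> :: rat poly) \<le> degree [:- of_int (2 * e), 1:: rat:]"
    by (rule dvd_imp_degree_le) simp
  then show False using degree_Phi d_gt_1 by simp
qed

text \<open>Multiplying \<Phi>'(\<theta>) = d r(\<theta>) s(\<theta>) by (\<theta>^2 - 4)
  r(\<theta>) s(\<theta>) completes both squares and produces d (t - 2) (t + 2).\<close>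

lemma conductor:
  assumes x: "x \<in> \<O>"
  shows "of_int (int d * ((t - 2) * (t + 2))) * x \<in> Ztheta"
proof -
  define r s where "r = cheb_half 1 k" and "s = cheb_half (- 1) k"
  have deriv: "pderiv \<Phi> = smult (int d) (r * s)"
    using pderiv_chebyshev_T[of 1 k] by (simp add: d(2) r_def s_def pderiv_diff add.commute)
  have r: "(\<theta> - 2) * (ipoly r \<theta>)\<^sup>2 = of_int (t - 2)"
    using root unfolding Phi_eq[of 1, simplified] r_def by (simp add: of_int_poly_simps left_diff_distrib)
  have s: "(\<theta> + 2) * (ipoly s \<theta>)\<^sup>2 = of_int (t + 2)"
    using root unfolding Phi_eq[of "- 1", simplified] s_def by (simp add: of_int_poly_simps distrib_right add.commute)
  have "of_int (int d * ((t - 2) * (t + 2))) * x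
    = of_nat d * (((\<theta> - 2) * (ipoly r \<theta>)\<^sup>2) * ((\<theta> + 2) * (ipoly s \<theta>)\<^sup>2)) * x"
    unfolding r s by simp
  also have "\<dots> = ((\<theta> - 2) * (\<theta> + 2) * ipoly r \<theta> * ipoly s \<theta>) * (of_nat d * (ipoly r \<theta> * ipoly s \<theta>) * x)"
    by (simp add: power2_eq_square mult_ac)
  also have "\<dots> = ipoly ([:- 2, 1:] * [:2, 1:] * r * s) \<theta> * (ipoly (pderiv \<Phi>) \<theta> * x)"
    unfolding deriv by (simp only: of_int_poly_simps poly_mult poly_smult) simp
  also have "\<dots> \<in> Ztheta" by (intro Ztheta_mult ipoly_in_Ztheta O_times_deriv x)
  finally show ?thesis .
qed

lemma conductor_nonzero: "int d * ((t - 2) * (t + 2)) \<noteq> 0"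
  using d_gt_1 t_neq[of 1] t_neq[of "- 1"] by simp

lemma Phi_mod_l:
  obtains h where "\<Phi> = [:- t, 1:] ^ degree \<Phi> + smult (int l) h"
proof -
  obtain h where "chebyshev_T (l ^ n) - [:t:] - [:- t, 1:] ^ (l ^ n) = [:int l:] * h"
    using chebyshev_T_prime_power_cong[OF l, of n t] by (rule dvdE)
  then have "\<Phi> - [:- t, 1:] ^ d = smult (int l) h" by (simp add: d(1))
  then have "\<Phi> = [:- t, 1:] ^ degree \<Phi> + smult (int l) h"
    unfolding degree_Phi by (metis diff_add_cancel add.commute)
  then show ?thesis by (rule that)
qed

lemma Phi_t_mod_l2: "(int l)\<^sup>2 dvd poly \<Phi> t \<longleftrightarrow> (int l)\<^sup>2 dvd poly (chebyshev_T l) t - t"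
proof -
  have "poly \<Phi> t = (poly (chebyshev_T (l ^ n)) t - poly (chebyshev_T l) t) + (poly (chebyshev_T l) t - t)"
    by (simp add: d(1))
  then show ?thesis using chebyshev_T_prime_power_cong_sq[OF l n, of t] by (simp only: dvd_add_right_iff)
qed

lemma tame_prime_cheb:
  assumes e: "e * e = 1" and p: "prime p" "p \<noteq> int l" "p dvd t - 2 * e" and sq: "squarefree (t - 2 * e)"
    and x: "x \<in> \<O>" "of_int p * x \<in> Ztheta"
  shows "x \<in> Ztheta"
proof -
  obtain u where u: "t - 2 * e = p * u" using p(3) by blast
  have "\<not> p\<^sup>2 dvd t - 2 * e"
    using sq p(1) not_prime_unit unfolding squarefree_def by blast
  then have "\<not> p dvd u" by (auto simp: u power2_eq_square)
  then have coprime_u: "coprime u p" using prime_imp_coprime[OF p(1)] by (subst coprime_commute)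
  obtain A B where AB: "A * ([:- 2 * e, 1:] * cheb_half e k) + B * pderiv ([:- 2 * e, 1:] * cheb_half e k)
      = [:(2 * int k + 1)\<^sup>2:]"
    using cheb_half_bezout[OF e] .
  \<comment> \<open>The Bezout constant is d^2, a power of l, hence prime to p.\<close>
  have "\<not> p dvd int l"
    using p(1,2) l(1) primes_dvd_imp_eq[of p "int l"] by auto
  then have "\<not> p dvd int d" using prime_dvd_power[OF p(1)] by (auto simp: d(1))
  then have "coprime p (int d)" by (rule prime_imp_coprime[OF p(1)])
  then have coprime_d: "coprime ((2 * int k + 1)\<^sup>2) p"
    by (subst coprime_commute) (simp add: d(2) add.commute)
  have "\<Phi> = [:- 2 * e, 1:] * (cheb_half e k)\<^sup>2 - [:p * u:]" using Phi_eq[OF e] u by simp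
  moreover have "lead_coeff ([:- 2 * e, 1:] * cheb_half e k) = 1"
    by (simp only: lead_coeff_mult cheb_half_monic[THEN conjunct2]) simp
  ultimately show ?thesis
    using tame_prime[OF conductor_nonzero conductor p(1) coprime_u _ _ AB coprime_d x] by blast
qed

lemma not_squarefree_imp:
  assumes e: "e * e = 1" and "\<not> squarefree (t - 2 * e)"
  shows "\<O> \<noteq> Ztheta"
proof -
  obtain m where m: "m\<^sup>2 dvd t - 2 * e" "\<not> is_unit m" using assms(2) by (auto simp: squarefree_def)
  have "m \<noteq> 0" using m(1) t_neq[OF e] by auto
  have nz: "cheb_half e k \<noteq> 0" using cheb_half_monic[of e k] by auto
  have "degree ([:- 2 * e, 1:] * cheb_half e k) = Suc k"
    using cheb_half_monic[of e k] nz by (subst degree_mult_eq) simp_all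
  \<comment> \<open>This is k + 1 < 2k + 1, where d > 1 gives k > 0.\<close>
  then have "degree ([:- 2 * e, 1:] * cheb_half e k) < degree \<Phi>"
    unfolding degree_Phi using d(2) d_gt_1 by linarith
  moreover have "lead_coeff ([:- 2 * e, 1:] * cheb_half e k) = 1"
    by (simp only: lead_coeff_mult cheb_half_monic[THEN conjunct2]) simp
  ultimately show ?thesis
    by (rule O_neq_if_square_divides[OF Phi_eq[OF e] m \<open>m \<noteq> 0\<close>, rotated])
qed

theorem maximal_order_iff:
  "\<O> = Ztheta \<longleftrightarrow>
    \<not> (int l)\<^sup>2 dvd poly (chebyshev_T l) t - t \<and> squarefree (t - 2) \<and> squarefree (t + 2)"
proof
  assume O: "\<O> = Ztheta"
  obtain h where h: "\<Phi> = [:- t, 1:] ^ degree \<Phi> + smult (int l) h" by (rule Phi_mod_l)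
  have pl: "prime (int l)" using l(1) by simp
  have "\<not> (int l)\<^sup>2 dvd poly \<Phi> t"
  proof
    assume "(int l)\<^sup>2 dvd poly \<Phi> t"
    then have "\<O> \<noteq> Ztheta"
      by (rule O_neq_if_totally_ramified_square[OF pl h]) (use degree_Phi d_gt_1 in simp)
    then show False using O by contradiction
  qed
  then show "\<not> (int l)\<^sup>2 dvd poly (chebyshev_T l) t - t \<and> squarefree (t - 2) \<and> squarefree (t + 2)"
    using O not_squarefree_imp[of 1] not_squarefree_imp[of "- 1"] Phi_t_mod_l2 by auto
next
  assume *: "\<not> (int l)\<^sup>2 dvd poly (chebyshev_T l) t - t \<and> squarefree (t - 2) \<and> squarefree (t + 2)"
  show "\<O> = Ztheta"
  proof (rule ccontr)
    assume neq: "\<O> \<noteq> Ztheta"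
    obtain p x where px: "prime p" "p dvd int d * ((t - 2) * (t + 2))" "x \<in> \<O>" "x \<notin> Ztheta"
        "of_int p * x \<in> Ztheta"
      by (rule O_prime_witness[OF conductor_nonzero conductor neq])
    show False
    proof (cases "p = int l")
      case True
      obtain h where h: "\<Phi> = [:- t, 1:] ^ degree \<Phi> + smult (int l) h" by (rule Phi_mod_l)
      have "x \<in> Ztheta"
        using wild_prime[OF px(1) h[folded True] _ px(3,5)] * Phi_t_mod_l2 True by blast
      then show False using px(4) by contradiction
    next
      case False
      have "\<not> p dvd int d"
      proof
        assume "p dvd int d"
        then have "p dvd int l" using prime_dvd_power[OF px(1), of "int l" n] by (simp add: d(1))
        then show False using False px(1) l(1) primes_dvd_imp_eq[of p "int l"] by auto
      qed
      then have "p dvd t - 2 \<or> p dvd t + 2"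
        using px(1,2) by (simp add: prime_dvd_mult_iff)
      then have "x \<in> Ztheta"
      proof
        assume "p dvd t - 2"
        then show ?thesis using tame_prime_cheb[of 1 p x] px False * by simp
      next
        assume "p dvd t + 2"
        then show ?thesis using tame_prime_cheb[of "- 1" p x] px False * by simp
      qed
      then show False using px(4) by contradiction
    qed
  qed
qed

end

theorem theorem3p5:
  fixes l n :: nat and t :: int and \<Phi> :: "int poly" and \<theta> :: complex
  assumes "prime l" and "odd l" and "n > 0"
    and "\<Phi> = chebyshev_T_iter l n - [:t:]"
    and "irreducible (map_poly rat_of_int \<Phi>)"
    and "poly (map_poly of_int \<Phi>) \<theta> = 0"
  shows "monic_discriminant (map_poly of_int \<Phi>) = field_discriminant (rat_adjoin \<theta>) \<longleftrightarrow>
    \<not> [poly (chebyshev_T l) t - t = 0] (mod (int l)\<^sup>2) \<and> squarefree (t - 2) \<and> squarefree (t + 2)"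
proof -
  have "l > 0" using assms(1) prime_gt_0_nat by blast
  then have \<Phi>: "\<Phi> = chebyshev_T (l ^ n) - [:t:]" using assms(4) by (simp add: chebyshev_T_iter_eq)
  have "odd (l ^ n)" using assms(2) by simp
  then obtain k where k: "l ^ n = 2 * k + 1" by (rule oddE)
  interpret chebyshev_prime_power l n k "l ^ n" t \<theta>
    using assms k unfolding \<Phi> by unfold_locales simp_all
  show ?thesis
    using field_discriminant_eq_iff[OF conductor_nonzero conductor] maximal_order_iff
    unfolding \<Phi> by (simp only: cong_0_iff)
qed

end
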